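(* Let $\beta,\gamma_0,\gamma$ satisfy $0<\beta<\frac{\pi}{2}$, $0<\gamma_0<2\sin\left(\frac{\beta}{2}\right)$ and $\gamma=2\arcsin\left(\frac{\gamma_0}{2}\right)<\beta$. Suppose that $$\kappa>\frac{\|\Omega\|}{\tilde I(\gamma)\sin\left(2\sin\frac{\gamma}{2}\right)}\qquad\text{and}\qquad R_i^0\in B_{\gamma_0}\quad\text{for all } i\in[N].$$ Let $\{R_i\}_{i=1}^N$ be the global solution to the homogeneous Winfree matrix model on $SO(n)$ (see context). Then, with the positive constant $\lambda_2:=\kappa\cos\gamma\,\tilde I(\gamma)>0$, $$\|R_i(t)-R_j(t)\|\le e^{-\lambda_2t}\,\|R_i^0-R_j^0\|,\qquad t>0,\quad i,j\in[N].$$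
   Context: Let $[N]=\{1,\dots,N\}$, let $I_n$ be the $n\times n$ identity matrix, and let $\mathfrak{so}(n)$ be the space of real skew-symmetric $n\times n$ matrices. On $\mathbb{R}^{n\times n}$ use $\langle A,B\rangle=\frac12\operatorname{tr}(A^TB)$ and $\|A\|=\sqrt{\langle A,A\rangle}$. Let $d$ be the geodesic (Riemannian) distance on $SO(n)$ for the metric $\langle\cdot,\cdot\rangle$ restricted to tangent spaces; if $R\in SO(n)$ has eigenvalues $e^{\pm \mathrm{i}\theta_1},\dots,e^{\pm\mathrm{i}\theta_m},1,\dots,1$ with $\theta_j\in(0,\pi]$, then $d(I_n,R)=\sqrt{\sum_j\theta_j^2}$. Put $B_r=\{R\in SO(n): d(I_n,R)<r\}$. The homogeneous (identical-oscillator) Winfree matrix model on $SO(n)$ is $$\dot R_i=\Omega R_i+\frac{\kappa}{2}\Big(\frac1N\sum_{j=1}^N I(R_j)\Big)(I_n-R_i^2),\quad t>0,\qquad R_i(0)=R_i^0\in SO(n),\quad i\in[N],$$ with a common $\Omega\in\mathfrak{so}(n)$ and $\kappa>0$. Standing assumptions on the influence function $I$: $I(R)=\tilde I(d(I_n,R))$ for a function $\tilde I:[0,\lfloor n/2\rfloor\pi]\to\mathbb{R}_{\ge0}$ that is decreasing (non-increasing), satisfies $\lim_{r\to0^+}\tilde I(r)=1$, is globally Lipschitz continuous, and has support $\operatorname{supp}\tilde I=[0,\beta]$ with $0<\beta<\frac{\pi}{2}$. *)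

theory Defs
  imports "HOL-Analysis.Analysis"
begin

definition SO :: "(real^'n^'n) set" where
  "SO = {R. rotation_matrix R}"

definition so :: "(real^'n^'n) set" where
  "so = {A. transpose A = - A}"

(* The normalisation 1/2 makes this differ from the inner product and norm that
   the type real^'n^'n carries in the library (the unnormalised Frobenius ones). *)
definition mat_inner :: "real^'n^'n \<Rightarrow> real^'n^'n \<Rightarrow> real" where
  "mat_inner A B = 1 / 2 * trace (transpose A ** B)"

definition mat_norm :: "real^'n^'n \<Rightarrow> real" where
  "mat_norm A = sqrt (mat_inner A A)"

(* Lengths of the piecewise C1 curves in SO(n) from P to Q.  Library piecewise C1 paths may have
   unbounded speed near a breakpoint; has_integral (rather than the total integral operator,
   which is 0 for non-integrable functions) restricts to curves whose speed is integrable. *)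
definition curve_lengths :: "real^'n^'n \<Rightarrow> real^'n^'n \<Rightarrow> real set" where
  "curve_lengths P Q = {L. \<exists>c. valid_path c \<and> path_image c \<subseteq> SO \<and> pathstart c = P \<and> pathfinish c = Q \<and>
     ((\<lambda>t. mat_norm (vector_derivative c (at t within {0..1}))) has_integral L) {0..1}}"

(* Riemannian distance; only meaningful for P, Q in SO(n). *)
definition geo_dist :: "real^'n^'n \<Rightarrow> real^'n^'n \<Rightarrow> real" where
  "geo_dist P Q = Inf (curve_lengths P Q)"

definition geo_ball :: "real \<Rightarrow> (real^'n^'n) set" where
  "geo_ball r = {R \<in> SO. geo_dist (mat 1) R < r}"

(* Standing assumptions on the radial profile of the influence function, a function on {0..D}.
   The values outside {0..D} are unconstrained and irrelevant. *)
definition influence_profile :: "real \<Rightarrow> real \<Rightarrow> (real \<Rightarrow> real) \<Rightarrow> bool" where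
  "influence_profile D \<beta> It \<longleftrightarrow>
     (\<forall>r\<in>{0..D}. 0 \<le> It r) \<and>
     antimono_on {0..D} It \<and>
     (It \<longlongrightarrow> 1) (at 0 within {0<..D}) \<and>
     (\<exists>L. L-lipschitz_on {0..D} It) \<and>
     closure {r\<in>{0..D}. It r \<noteq> 0} = {0..\<beta>}"

definition influence :: "(real \<Rightarrow> real) \<Rightarrow> real^'n^'n \<Rightarrow> real" where
  "influence It R = It (geo_dist (mat 1) R)"

(* Global solution on [0, \<infinity>) of the homogeneous Winfree matrix model with N oscillators:
   R i t is R_i(t), for i in {1..N}; other indices i and negative t are irrelevant. *)
definition winfree_solution ::
  "nat \<Rightarrow> real^'n^'n \<Rightarrow> real \<Rightarrow> (real \<Rightarrow> real) \<Rightarrow> (nat \<Rightarrow> real^'n^'n) \<Rightarrow> (nat \<Rightarrow> real \<Rightarrow> real^'n^'n) \<Rightarrow> bool"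
where
  "winfree_solution N \<Omega> \<kappa> It R0 R \<longleftrightarrow>
     (\<forall>i\<in>{1..N}.
        (\<forall>t\<ge>0. R i t \<in> SO) \<and>
        continuous_on {0..} (R i) \<and>
        R i 0 = R0 i \<and>
        (\<forall>t>0. (R i has_vector_derivative
           \<Omega> ** R i t +
           (\<kappa> / 2 * (1 / real N * (\<Sum>j\<in>{1..N}. influence It (R j t)))) *\<^sub>R (mat 1 - R i t ** R i t))
           (at t)))"

end

theory Submission
  imports Defs
begin

text \<open>Write \<open>D = n - trace R = \<parallel>R - 1\<parallel>\<^sup>2\<close>. The nonzero eigenvalues of
  \<open>(R - 1)\<^sup>T (R - 1)\<close> occur in pairs when \<open>D < 2\<close>, and this yields
  \<open>n - trace R\<^sup>2 \<ge> D (4 - D)\<close>. Applied along the Cayley curve from \<open>1\<close> to \<open>R\<close> the inequality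
  bounds the geodesic distance by \<open>arccos (1 - D/2)\<close>, so \<open>D \<le> \<gamma>0\<^sup>2\<close> keeps the
  influence at least \<open>It \<gamma>\<close>. Applied to an oscillator with \<open>D = \<gamma>0\<^sup>2\<close>, it shows that
  \<open>D\<close> decreases there, because the coupling term beats \<open>\<Omega>\<close>; hence the chordal ball is never left.
  In that ball the symmetric part of every \<open>R\<^sub>i\<close> is at least \<open>cos \<gamma>\<close>, and since
  \<open>2 (P\<^sup>2 - Q\<^sup>2) = (P + Q) (P - Q) + (P - Q) (P + Q)\<close>, the squared norm of
  \<open>R\<^sub>i - R\<^sub>j\<close> decays at the rate \<open>2 \<kappa> cos \<gamma> It \<gamma>\<close>.\<close>

subsection \<open>Matrix inner products\<close>

text \<open>Provides bilinear algebra, limits, continuity and the product rule for matrix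
  multiplication under the prefix \<open>matmul\<close>.\<close>

interpretation matmul: bounded_bilinear "(**) :: real^'n^'n \<Rightarrow> real^'n^'n \<Rightarrow> real^'n^'n"
  unfolding bilinear_conv_bounded_bilinear[symmetric] bilinear_def
  by (auto intro!: linearI simp: matrix_add_ldistrib matrix_matrix_mult_def vec_eq_iff sum.distrib sum_distrib_left algebra_simps)

lemma inner_eq_trace: "A \<bullet> B = trace (transpose A ** B)" for A B :: "real^'n^'n"
  unfolding trace_def inner_vec_def matrix_matrix_mult_def transpose_def
  by (simp, subst sum.swap, simp)

lemma inner_transpose: "transpose A \<bullet> transpose B = A \<bullet> B" for A B :: "real^'n^'n"
  unfolding inner_vec_def transpose_def by (simp, subst sum.swap, simp)

lemma inner_mat_1: "mat 1 \<bullet> A = trace A" for A :: "real^'n^'n"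
  by (simp add: inner_eq_trace)

lemma mat_norm_power2: "(mat_norm A)^2 = (norm A)^2 / 2"
  by (simp add: mat_norm_def mat_inner_def power2_norm_eq_inner flip: inner_eq_trace)

lemma mat_norm_eq: "mat_norm A = norm A / sqrt 2"
  by (simp add: mat_norm_def mat_inner_def real_sqrt_divide norm_eq_sqrt_inner flip: inner_eq_trace)

lemma transpose_minus: "transpose (A - B) = transpose A - transpose B"
  and transpose_plus: "transpose (A + B) = transpose A + transpose B"
  for A B :: "real^'n^'n"
  by (simp_all add: transpose_def vec_eq_iff)

lemma column_mult: "column j (A ** B) = A *v column j B" for A B :: "real^'n^'n"
  by (simp add: vec_eq_iff column_def matrix_matrix_mult_def matrix_vector_mult_def)

lemma inner_columns: "A \<bullet> B = (\<Sum>j\<in>UNIV. column j A \<bullet> column j B)" for A B :: "real^'n^'n"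
  unfolding inner_vec_def column_def by (simp, subst sum.swap, simp)

lemma orthogonal_matrix_inner:
  fixes R :: "real^'n^'n"
  assumes "orthogonal_matrix R" shows "(R *v x) \<bullet> (R *v y) = x \<bullet> y"
  using assms orthogonal_transformation_matrix[of "(*v) R"]
  by (simp add: orthogonal_transformation_def)

subsection \<open>Displacement of an orthogonal matrix\<close>

text \<open>Expand the square; orthogonality gives \<open>R \<bullet> R = CARD('n)\<close>. After
  the factor 1/2 in \<open>mat_norm\<close>, the squared chord from the identity is exactly
  \<open>CARD('n) - trace R\<close>, the quantity followed from here on.\<close>

lemma norm_orthogonal_minus_mat_1:
  fixes R :: "real^'n^'n"
  assumes "orthogonal_matrix R"
  shows "(norm (R - mat 1))^2 = 2 * (real CARD('n) - trace R)"
proof -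
  have "R \<bullet> R = real CARD('n)"
    using assms by (simp add: inner_eq_trace orthogonal_matrix_def trace_I)
  moreover have "R \<bullet> mat 1 = trace R"  "mat 1 \<bullet> (mat 1 :: real^'n^'n) = real CARD('n)"
    by (metis inner_mat_1 inner_commute trace_I)+
  ultimately show ?thesis
    by (simp add: power2_norm_eq_inner inner_diff_left inner_diff_right inner_mat_1)
qed

lemma norm_matrix_vector_rows: "(norm (B *v z))^2 = (\<Sum>i\<in>UNIV. (B$i \<bullet> z)^2)" for B :: "real^'n^'n"
  unfolding power2_norm_eq_inner inner_vec_def[of "B *v z"]
  by (simp add: matrix_vector_mul_component power2_eq_square)

lemma norm_matrix_rows: "(norm B)^2 = (\<Sum>i\<in>UNIV. B$i \<bullet> B$i)" for B :: "real^'n^'n"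
  unfolding power2_norm_eq_inner inner_vec_def[of B B] ..

text \<open>Bessel's inequality for the pair \<open>z\<close>, \<open>y\<close>, applied to each row
  of \<open>B\<close> and summed over the rows.\<close>

lemma norm_orthonormal_pair_le:
  fixes B :: "real^'n^'n"
  assumes "z \<bullet> z = 1" "y \<bullet> y = 1" "z \<bullet> y = 0"
  shows "(norm (B *v z))^2 + (norm (B *v y))^2 \<le> (norm B)^2"
proof -
  have "(r \<bullet> z)^2 + (r \<bullet> y)^2 \<le> r \<bullet> r" for r :: "real^'n"
  proof -
    have "0 \<le> (r - (r \<bullet> z) *\<^sub>R z - (r \<bullet> y) *\<^sub>R y) \<bullet> (r - (r \<bullet> z) *\<^sub>R z - (r \<bullet> y) *\<^sub>R y)"
      by simp
    also have "\<dots> = r \<bullet> r - (r \<bullet> z)^2 - (r \<bullet> y)^2"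
      using assms by (simp add: inner_diff_left inner_diff_right inner_commute[of y z]
          inner_commute[of y r] inner_commute[of z r] power2_eq_square algebra_simps)
    finally show ?thesis by simp
  qed
  then have "(\<Sum>i\<in>UNIV. (B$i \<bullet> z)^2 + (B$i \<bullet> y)^2) \<le> (\<Sum>i\<in>UNIV. B$i \<bullet> B$i)"
    by (intro sum_mono)
  then show ?thesis
    by (simp add: norm_matrix_vector_rows norm_matrix_rows sum.distrib)
qed

text \<open>The eigenvalues of \<open>(R - 1)\<^sup>T (R - 1)\<close> come in equal pairs unless they belong to the
  eigenvalues \<open>1\<close> and \<open>-1\<close> of \<open>R\<close>; the smallness assumption excludes \<open>-1\<close>.
  Hence the largest one is at most half of the trace.\<close>
lemma orthogonal_displacement_le:
  fixes R :: "real^'n^'n"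
  assumes R: "orthogonal_matrix R" and small: "(norm (R - mat 1))^2 < 4"
  shows "2 * (norm (R *v x - x))^2 \<le> (norm (R - mat 1))^2 * (norm x)^2"
proof -
  define B where "B = R - mat 1"
  have Bv: "B *v v = R *v v - v" for v
    by (simp add: B_def matrix_vector_mult_diff_rdistrib)
  \<comment> \<open>By compactness a maximiser \<open>z\<close> exists; \<open>\<mu>\<close> will be
    the largest eigenvalue of \<open>transpose B ** B\<close>.\<close>
  have "\<exists>z\<in>sphere 0 1. \<forall>v\<in>sphere 0 1. norm (B *v v) \<le> norm (B *v z)"
    by (intro continuous_attains_sup continuous_on_norm linear_continuous_on matrix_vector_mul_bounded_linear) auto
  then obtain z where z: "norm z = 1" and zmax: "\<And>v. norm v = 1 \<Longrightarrow> norm (B *v v) \<le> norm (B *v z)"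
    by (auto simp: dist_norm)
  define \<mu> where "\<mu> = (norm (B *v z))^2"
  have zz: "z \<bullet> z = 1" using z by (simp add: norm_eq_1)
  have \<mu>0: "\<mu> \<ge> 0" by (simp add: \<mu>_def)
  have le: "(norm (B *v v))^2 \<le> \<mu> * (norm v)^2" for v
  proof (cases "v = 0")
    case False
    have "norm (B *v ((1 / norm v) *\<^sub>R v)) \<le> norm (B *v z)"
      using False by (intro zmax) simp
    then have "norm (B *v v) \<le> norm (B *v z) * norm v"
      using False by (simp add: matrix_vector_mult_scaleR divide_simps)
    then have "(norm (B *v v))^2 \<le> (norm (B *v z) * norm v)^2" by (intro power_mono) auto
    then show ?thesis by (simp add: \<mu>_def power_mult_distrib)
  qed simp
  \<comment> \<open>\<open>h = 0\<close> is the eigenvector equation for \<open>z\<close>. It holds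
    because the quadratic form \<open>\<mu> * (v \<bullet> v) - (B *v v) \<bullet> (B *v v)\<close>
    is nonnegative and vanishes at \<open>z\<close>, while its derivative there in direction
    \<open>h\<close> is \<open>2 * (h \<bullet> h)\<close>.\<close>
  define h where "h = \<mu> *\<^sub>R z - transpose B *v (B *v z)"
  have q: "\<mu> * (z \<bullet> v) - (B *v z) \<bullet> (B *v v) = h \<bullet> v" for v
    by (simp add: h_def inner_diff_left dot_lmul_matrix)
  have "h = 0"
  proof -
    define c where "c = \<mu> * (h \<bullet> h) - (B *v h) \<bullet> (B *v h)"
    have c0: "c \<ge> 0" using le[of h] by (simp add: c_def power2_norm_eq_inner)
    \<comment> \<open>The minimising step would be \<open>- (h \<bullet> h) / c\<close>; the added 1
      covers \<open>c = 0\<close> and still makes the form negative unless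
      \<open>h = 0\<close>.\<close>
    define t where "t = - (h \<bullet> h) / (c + 1)"
    have "0 \<le> \<mu> * ((z + t *\<^sub>R h) \<bullet> (z + t *\<^sub>R h)) - (B *v (z + t *\<^sub>R h)) \<bullet> (B *v (z + t *\<^sub>R h))"
      using le[of "z + t *\<^sub>R h"] by (simp add: power2_norm_eq_inner)
    also have "\<dots> = 2 * t * (\<mu> * (z \<bullet> h) - (B *v z) \<bullet> (B *v h)) + t^2 * c"
      using zz \<mu>_def[unfolded power2_norm_eq_inner, symmetric]
      by (simp add: c_def inner_add_left inner_add_right
         matrix_vector_right_distrib matrix_vector_mult_scaleR power2_eq_square algebra_simps inner_commute[of h z] inner_commute[of "B *v h" "B *v z"])
    also have "\<dots> = 2 * t * (h \<bullet> h) + t^2 * c" by (simp only: q)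
    also have "\<dots> = - ((h \<bullet> h)^2 * (c + 2)) / (c+1)^2"
      using c0 unfolding t_def by (simp add: divide_simps power2_eq_square) algebra
    finally have "(h \<bullet> h)^2 * (c + 2) / (c+1)^2 \<le> 0" by simp
    then have "(h \<bullet> h)^2 \<le> 0" using c0 by (simp add: divide_le_0_iff mult_le_0_iff)
    then show ?thesis by simp
  qed
  define a where "a = z \<bullet> (R *v z)"
  have RR: "(R *v u) \<bullet> (R *v v) = u \<bullet> v" for u v using R by (rule orthogonal_matrix_inner)
  have \<mu>a: "\<mu> = 2 - 2 * a"
    by (simp add: \<mu>_def power2_norm_eq_inner Bv inner_diff_left inner_diff_right RR zz a_def inner_commute)
  have RTR: "transpose R *v (R *v v) = v" "R *v (transpose R *v v) = v" for v
    using R by (simp_all add: matrix_vector_mul_assoc orthogonal_matrix_def del: transpose_matrix_vector)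
  have "transpose B *v v = transpose R *v v - v" for v
    by (simp add: B_def transpose_minus matrix_vector_mult_diff_rdistrib del: transpose_matrix_vector)
  \<comment> \<open>As \<open>transpose B ** B\<close> equals \<open>2 - R - transpose R\<close>,
    the eigenvector equation becomes a linear relation between \<open>z\<close>,
    \<open>R *v z\<close> and \<open>transpose R *v z\<close>. Applying \<open>R\<close> shows that
    \<open>z\<close> and \<open>R *v z\<close> span an \<open>R\<close>-invariant space.\<close>
  then have "\<mu> *\<^sub>R z = 2 *\<^sub>R z - R *v z - transpose R *v z"
    using \<open>h = 0\<close> by (simp add: h_def Bv matrix_vector_mult_diff_distrib RTR scaleR_2 del: transpose_matrix_vector)
  then have "transpose R *v z = (2 * a) *\<^sub>R z - R *v z"
    by (simp add: \<mu>a algebra_simps del: transpose_matrix_vector)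
  then have "R *v (transpose R *v z) = R *v ((2 * a) *\<^sub>R z - R *v z)"
    by (simp only:)
  then have Rz2: "R *v (R *v z) = (2 * a) *\<^sub>R (R *v z) - z"
    by (simp add: RTR matrix_vector_mult_diff_distrib matrix_vector_mult_scaleR algebra_simps del: transpose_matrix_vector)
  \<comment> \<open>The part of \<open>R *v z\<close> orthogonal to \<open>z\<close>; it is
    stretched by \<open>B\<close> as much as \<open>z\<close> is, which supplies the second member
    of the eigenvalue pair.\<close>
  define w where "w = R *v z - a *\<^sub>R z"
  have Bw: "B *v w = (a - 1) *\<^sub>R (R *v z + z)"
    by (simp add: Bv w_def Rz2 matrix_vector_mult_diff_distrib matrix_vector_mult_scaleR vec_eq_iff algebra_simps)
  have ww: "w \<bullet> w = 1 - a^2" and wz: "z \<bullet> w = 0"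
    by (simp_all add: w_def inner_diff_left inner_diff_right RR zz a_def[symmetric] inner_commute[of "R *v z" z] power2_eq_square)
  have Bww: "(norm (B *v w))^2 = \<mu> * (w \<bullet> w)"
    unfolding Bw ww \<mu>a
    by (simp add: power_mult_distrib power2_norm_eq_inner inner_add_left inner_add_right RR zz a_def[symmetric] inner_commute[of "R *v z" z])
       (simp add: power2_eq_square algebra_simps)
  have key: "2 * \<mu> \<le> (norm B)^2"
  proof (cases "\<mu> = 0")
    case False
    \<comment> \<open>With \<open>\<mu> = 2 - 2 * a\<close> and
      \<open>w \<bullet> w = 1 - a^2\<close>, the vector \<open>w\<close> vanishes only if
      \<open>\<mu>\<close> is 0 or 4. The value 4 would mean the eigenvalue -1 of
      \<open>R\<close>.\<close>
    have "\<mu> < 4"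
    proof -
      have "(norm (B *v z))^2 = (\<Sum>i\<in>UNIV. (B$i \<bullet> z)^2)" by (rule norm_matrix_vector_rows)
      also have "\<dots> \<le> (\<Sum>i\<in>UNIV. B$i \<bullet> B$i)"
        using Cauchy_Schwarz_ineq[of _ z] zz by (intro sum_mono) simp
      also have "\<dots> = (norm B)^2" by (rule norm_matrix_rows[symmetric])
      finally show ?thesis using small unfolding \<mu>_def B_def by linarith
    qed
    with False \<mu>0 have "w \<bullet> w > 0" unfolding ww \<mu>a
      by (simp add: abs_square_less_1)
    define y where "y = (1 / norm w) *\<^sub>R w"
    have "y \<bullet> y = 1" "z \<bullet> y = 0" using \<open>w \<bullet> w > 0\<close> wz
      by (auto simp: y_def norm_eq_1[symmetric] simp flip: power2_norm_eq_inner power2_eq_square)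
    moreover have "(norm (B *v y))^2 = \<mu>"
      using Bww \<open>w \<bullet> w > 0\<close>
      by (simp add: y_def matrix_vector_mult_scaleR power_divide power2_norm_eq_inner[of w])
    ultimately show ?thesis using norm_orthonormal_pair_le[OF zz, of y B] by (simp add: \<mu>_def)
  qed simp
  have "2 * (norm (B *v x))^2 \<le> (2 * \<mu>) * (norm x)^2" using le[of x] by simp
  also have "\<dots> \<le> (norm B)^2 * (norm x)^2" by (intro mult_right_mono key) simp
  finally show ?thesis by (simp add: Bv B_def matrix_vector_mult_diff_rdistrib)
qed

text \<open>The squared Frobenius norm of \<open>transpose B ** B\<close> is at most its largest
  eigenvalue times its trace, hence at most \<open>D * (2 * D)\<close>. Expanding the same norm
  through \<open>2 - R - transpose R\<close> brings in \<open>trace (R ** R)\<close>. For a single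
  plane rotation equality holds, by the double-angle formula.\<close>

lemma orthogonal_trace_square_le:
  fixes R :: "real^'n^'n"
  assumes R: "orthogonal_matrix R" and small: "real CARD('n) - trace R < 2"
  defines "D \<equiv> real CARD('n) - trace R"
  shows "real CARD('n) - trace (R ** R) \<ge> D * (4 - D)"
proof -
  define B where "B = R - mat 1"
  have nB: "(norm B)^2 = 2 * D" using norm_orthogonal_minus_mat_1[OF R] by (simp add: B_def D_def)
  have disp: "(norm (B *v v))^2 \<le> D * (norm v)^2" for v
  proof -
    have "2 * (norm (B *v v))^2 \<le> (2 * D) * (norm v)^2"
      using orthogonal_displacement_le[OF R, of v] small
      unfolding nB[symmetric] by (simp add: B_def norm_orthogonal_minus_mat_1[OF R] matrix_vector_mult_diff_rdistrib)
    then show ?thesis by simp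
  qed
  \<comment> \<open>\<open>transpose B = - (transpose R ** B)\<close>, and
    \<open>transpose R\<close> is an isometry.\<close>
  have T: "norm (transpose B *v v) = norm (B *v v)" for v
  proof -
    have "transpose B *v v = - (transpose R *v (B *v v))"
      using R by (simp add: B_def transpose_minus matrix_vector_mult_diff_rdistrib matrix_vector_mult_diff_distrib
        matrix_vector_mul_assoc orthogonal_matrix_def del: transpose_matrix_vector)
    moreover have "norm (transpose R *v u) = norm u" for u
      using orthogonal_matrix_inner[of "transpose R" u u] R by (simp add: norm_eq_sqrt_inner)
    ultimately show ?thesis by simp
  qed
  have "(norm (transpose B ** B))^2 = (\<Sum>j\<in>UNIV. (norm (B *v column j B))^2)"
    by (simp add: power2_norm_eq_inner[of "transpose B ** B"] inner_columns column_mult T del: transpose_matrix_vector flip: power2_norm_eq_inner)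
  also have "\<dots> \<le> (\<Sum>j\<in>UNIV. D * (norm (column j B))^2)" by (intro sum_mono disp)
  also have "\<dots> = D * (norm B)^2"
    by (simp add: power2_norm_eq_inner inner_columns[of B] sum_distrib_left)
  finally have 1: "(norm (transpose B ** B))^2 \<le> 2 * D^2" unfolding nB by (simp add: power2_eq_square)
  have M: "transpose B ** B = 2 *\<^sub>R mat 1 - R - transpose R"
    using R by (simp add: B_def transpose_minus matmul.diff_left matmul.diff_right orthogonal_matrix_def scaleR_2)
  have "R \<bullet> R = real CARD('n)" "transpose R \<bullet> transpose R = real CARD('n)"
    using R by (simp_all add: inner_eq_trace orthogonal_matrix_def trace_I)
  moreover have "R \<bullet> transpose R = trace (R ** R)" 
    using inner_transpose[of "transpose R" R] by (simp add: inner_eq_trace)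
  moreover have "R \<bullet> mat 1 = trace R" "transpose R \<bullet> mat 1 = trace R" "mat 1 \<bullet> transpose R = trace R"
    by (simp_all add: inner_eq_trace) (simp_all add: trace_def transpose_def)
  moreover have "mat 1 \<bullet> (mat 1 :: real^'n^'n) = real CARD('n)"
    by (simp add: inner_mat_1 trace_I)
  ultimately have "(norm (transpose B ** B))^2 = 6 * real CARD('n) - 8 * trace R + 2 * trace (R ** R)"
    unfolding M power2_norm_eq_inner
    by (simp add: inner_diff_left inner_diff_right inner_mat_1 inner_commute[of "transpose R" R])
  with 1 show ?thesis by (simp add: D_def power2_eq_square algebra_simps)
qed

subsection \<open>Curve lengths and the Cayley curve\<close>

lemma curve_lengths_C1:
  assumes "\<And>t. (c has_vector_derivative c' t) (at t)" and "continuous_on UNIV c'"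
    and "\<And>t. t \<in> {0..1} \<Longrightarrow> c t \<in> SO"
  shows "integral {0..1} (\<lambda>t. mat_norm (c' t)) \<in> curve_lengths (c 0) (c 1)"
proof -
  have "c C1_differentiable_on {0..1}"
    unfolding C1_differentiable_on_def using assms(1,2) continuous_on_subset by blast
  then have "valid_path c" by (simp add: valid_path_def C1_differentiable_imp_piecewise)
  moreover have "((\<lambda>t. mat_norm (vector_derivative c (at t within {0..1}))) has_integral
      integral {0..1} (\<lambda>t. mat_norm (c' t))) {0..1}"
  proof (rule has_integral_eq)
    have "continuous_on {0..1} (\<lambda>t. mat_norm (c' t))"
      unfolding mat_norm_eq by (intro continuous_intros continuous_on_subset[OF assms(2)]) auto
    then show "((\<lambda>t. mat_norm (c' t)) has_integral integral {0..1} (\<lambda>t. mat_norm (c' t))) {0..1}"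
      by (intro integrable_integral integrable_continuous_interval)
    \<comment> \<open>The one-sided derivatives at 0 and 1 agree with \<open>c'\<close>, since
      \<open>c\<close> is differentiable on the whole line.\<close>
    show "mat_norm (c' t) = mat_norm (vector_derivative c (at t within {0..1}))" if "t \<in> {0..1}" for t
      using that assms(1)[of t] vector_derivative_within_cbox[of 0 1 t c "c' t"]
      by (simp add: has_vector_derivative_at_within)
  qed
  ultimately show ?thesis
    unfolding curve_lengths_def pathstart_def pathfinish_def path_image_def using assms(3)
    by (intro CollectI exI[of _ c]) auto
qed

text \<open>A chord is no longer than a curve: the norm of the integral of the velocity is at most
  the integral of its norm. The fundamental theorem is used in the form that allows finitely many
  exceptional points, so unbounded speed near a breakpoint does no harm.\<close>

lemma mat_norm_le_curve_lengths:
  assumes "L \<in> curve_lengths P Q"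
  shows "mat_norm (Q - P) \<le> L"
proof -
  from assms obtain c where c: "valid_path c" "c 0 = P" "c 1 = Q"
     and L: "((\<lambda>t. mat_norm (vector_derivative c (at t within {0..1}))) has_integral L) {0..1}"
    by (auto simp: curve_lengths_def pathstart_def pathfinish_def)
  then obtain S where S: "finite S" "continuous_on {0..1} c" and d: "c C1_differentiable_on ({0..1} - S)"
    by (auto simp: valid_path_def piecewise_C1_differentiable_on_def)
  let ?f = "\<lambda>t. vector_derivative c (at t within {0..1})"
  have "(c has_vector_derivative ?f x) (at x)" if "x \<in> {0<..<1} - S" for x
  proof -
    have "(c has_vector_derivative vector_derivative c (at x)) (at x)"
      using d that by (simp add: C1_differentiable_on_eq vector_derivative_works[symmetric])
    moreover have "?f x = vector_derivative c (at x)"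
      using that calculation by (intro vector_derivative_within_cbox[of 0 1, simplified])
        (auto intro: has_vector_derivative_at_within)
    ultimately show ?thesis by simp
  qed
  then have "(?f has_integral (Q - P)) {0..1}"
    using fundamental_theorem_of_calculus_interior_strong[of S 0 1 c ?f] S c by simp
  moreover have "((\<lambda>t. norm (?f t)) has_integral (sqrt 2 * L)) {0..1}"
    using has_integral_mult_right[OF L, of "sqrt 2"] by (simp add: mat_norm_eq)
  ultimately have "norm (Q - P) \<le> sqrt 2 * L"
    using integral_norm_bound_integral[of ?f "{0..1}" "\<lambda>t. norm (?f t)"] integral_unique
    by (metis has_integral_integrable order_refl)
  then show ?thesis by (simp add: mat_norm_eq divide_simps mult.commute)
qed

text \<open>Nonemptiness is assumed because the infimum of an empty set of reals has no meaningful
  value.\<close>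

lemma geo_dist_nonneg:
  assumes "curve_lengths P Q \<noteq> {}" shows "0 \<le> geo_dist P Q"
  unfolding geo_dist_def
proof (rule cInf_greatest[OF assms])
  show "0 \<le> L" if "L \<in> curve_lengths P Q" for L
    using mat_norm_le_curve_lengths[OF that] by (smt (verit) mat_norm_eq divide_nonneg_nonneg norm_ge_zero real_sqrt_ge_zero)
qed

lemma geo_dist_le:
  assumes "L \<in> curve_lengths P Q" shows "geo_dist P Q \<le> L"
proof -
  have "bdd_below (curve_lengths P Q)"
    using mat_norm_le_curve_lengths by (intro bdd_belowI) blast
  with assms show ?thesis by (simp add: geo_dist_def cInf_lower)
qed

lemma mat_norm_le_geo_dist:
  assumes "curve_lengths P Q \<noteq> {}" shows "mat_norm (Q - P) \<le> geo_dist P Q"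
  unfolding geo_dist_def by (intro cInf_greatest assms mat_norm_le_curve_lengths)

section \<open>Resolvents of skew-symmetric matrices and the Cayley transform\<close>

lemma skew_inner_eq_0:
  fixes A :: "real^'n^'n"
  assumes "transpose A = - A"
  shows "x \<bullet> (A *v x) = 0"
proof -
  have "x \<bullet> (A *v x) = (transpose A *v x) \<bullet> x"
    by (simp add: dot_lmul_matrix)
  also have "transpose A *v x = - (A *v x)"
    using matrix_vector_mult_diff_rdistrib[of 0 A x] by (simp add: assms del: transpose_matrix_vector)
  finally show ?thesis by (simp add: inner_commute)
qed

text \<open>\<open>Q s\<close> is the inverse of \<open>1 - s A\<close>. Skewness makes
  \<open>x\<close> and \<open>A *v x\<close> orthogonal, so \<open>1 - s A\<close> does not shrink
  vectors: the inverse exists for every real \<open>s\<close> and is a contraction. Continuity and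
  the derivative follow from the resolvent identity.\<close>

lemma skew_resolvent:
  fixes A :: "real^'n^'n"
  assumes A: "transpose A = - A"
  obtains Q where "\<And>s. Q s ** (mat 1 - s *\<^sub>R A) = mat 1" "\<And>s. (mat 1 - s *\<^sub>R A) ** Q s = mat 1"
    "\<And>s. (Q has_vector_derivative (Q s ** A ** Q s)) (at s)" "continuous_on UNIV Q"
proof -
  define M where "M = (\<lambda>s. mat 1 - s *\<^sub>R A)"
  have Mv: "M s *v x = x - s *\<^sub>R (A *v x)" for s x
    by (simp add: M_def matrix_vector_mult_diff_rdistrib scaleR_matrix_vector_assoc)
  have Mx: "norm x \<le> norm (M s *v x)" for s x
  proof -
    have "(norm (M s *v x))^2 = (norm x)^2 + s^2 * (norm (A *v x))^2"
      using skew_inner_eq_0[OF A, of x] unfolding power2_norm_eq_inner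
      by (simp add: Mv inner_diff_left inner_diff_right inner_commute[of "A *v x" x] power2_eq_square)
    then have "(norm x)^2 \<le> (norm (M s *v x))^2" by simp
    then show ?thesis by (rule power2_le_imp_le) simp
  qed
  have "\<exists>B. B ** M s = mat 1" for s
    unfolding matrix_left_invertible_ker by (metis Mx norm_le_zero_iff norm_zero)
  then obtain Q where QM: "\<And>s. Q s ** M s = mat 1" by metis
  then have MQ: "M s ** Q s = mat 1" for s by (simp add: matrix_left_right_inverse)
  have bound: "norm (Q s ** X) \<le> norm X" for s and X :: "real^'n^'n"
  proof -
    have "norm (Q s *v v) \<le> norm v" for v
      using Mx[of "Q s *v v" s] by (simp add: matrix_vector_mul_assoc MQ)
    then have "(norm (Q s ** X))^2 \<le> (norm X)^2"
      unfolding power2_norm_eq_inner inner_columns[of X] inner_columns[of "_ ** _"] column_mult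
      by (intro sum_mono) (simp flip: power2_norm_eq_inner)
    then show ?thesis by (rule power2_le_imp_le) simp
  qed
  \<comment> \<open>The resolvent identity; together with \<open>bound\<close> it makes
    \<open>Q\<close> Lipschitz around \<open>x\<close>.\<close>
  have diff: "Q y - Q x = (y - x) *\<^sub>R (Q y ** A ** Q x)" for x y
  proof -
    have "Q y ** (M x - M y) ** Q x = Q y - Q x"
      by (simp add: matmul.diff_left matmul.diff_right QM matrix_mul_assoc[symmetric] MQ)
    moreover have "M x - M y = (y - x) *\<^sub>R A" by (simp add: M_def algebra_simps)
    ultimately show ?thesis by (simp add: matmul.scaleR_left matmul.scaleR_right)
  qed
  have "isCont Q x" for x
  proof -
    have "((\<lambda>y. Q y - Q x) \<longlongrightarrow> 0) (at x)"
    proof (rule tendsto_0_le)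
      show "((\<lambda>y. y - x) \<longlongrightarrow> 0) (at x)" by (auto intro!: tendsto_eq_intros)
      have "norm (Q y - Q x) \<le> norm (y - x) * norm (A ** Q x)" for y
        unfolding diff using bound[of y "A ** Q x"] by (simp add: mult_left_mono matrix_mul_assoc)
      then show "\<forall>\<^sub>F y in at x. norm (Q y - Q x) \<le> norm (y - x) * norm (A ** Q x)" by simp
    qed
    then show ?thesis by (simp add: isCont_def LIM_zero_iff)
  qed
  then have cont: "continuous_on UNIV Q" by (simp add: continuous_at_imp_continuous_on)
  have "(Q has_vector_derivative (Q x ** A ** Q x)) (at x)" for x
    unfolding has_vector_derivative_def has_derivative_iff_norm
  proof (intro conjI bounded_linear_scaleR_left)
    have "((\<lambda>y. norm ((Q y - Q x) ** (A ** Q x))) \<longlongrightarrow> norm ((Q x - Q x) ** (A ** Q x))) (at x)"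
      using \<open>isCont Q x\<close> unfolding isCont_def
      by (intro tendsto_norm matmul.tendsto tendsto_intros)
    then have "((\<lambda>y. norm ((Q y - Q x) ** (A ** Q x))) \<longlongrightarrow> 0) (at x)" by simp
    then show "((\<lambda>y. norm (Q y - Q x - (y - x) *\<^sub>R (Q x ** A ** Q x)) / norm (y - x)) \<longlongrightarrow> 0) (at x)"
    proof (rule Lim_transform_eventually)
      have "norm ((Q y - Q x) ** (A ** Q x)) = norm (Q y - Q x - (y - x) *\<^sub>R (Q x ** A ** Q x)) / norm (y - x)"
        if "y \<noteq> x" for y
      proof -
        have "Q y - Q x - (y - x) *\<^sub>R (Q x ** A ** Q x) = (y - x) *\<^sub>R ((Q y - Q x) ** (A ** Q x))"
        proof -
          have "(Q y - Q x) ** (A ** Q x) = Q y ** A ** Q x - Q x ** A ** Q x"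
            by (simp only: matmul.diff_left matrix_mul_assoc)
          then show ?thesis unfolding scaleR_diff_right[symmetric] using diff[where x=x and y=y]
            by (simp only: scaleR_diff_right)
        qed
        then show ?thesis using that by simp
      qed
      then show "\<forall>\<^sub>F y in at x. norm ((Q y - Q x) ** (A ** Q x)) =
          norm (Q y - Q x - (y - x) *\<^sub>R (Q x ** A ** Q x)) / norm (y - x)"
        by (auto simp: eventually_at_filter)
    qed
  qed
  with QM MQ cont show ?thesis using that unfolding M_def by blast
qed

text \<open>The curve is \<open>(1 + s A) (1 - s A)^{-1}\<close>, that is \<open>2 Q - 1\<close> for
  the resolvent \<open>Q\<close>. The relation between \<open>c'\<close> and
  \<open>c s ** c s\<close> lets both its speed and the derivative of its trace be read off from the
  square.\<close>

lemma cayley_curve: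
  fixes A :: "real^'n^'n"
  assumes A: "transpose A = - A"
  obtains c c' where "\<And>s. (c has_vector_derivative c' s) (at s)" "continuous_on UNIV c'" "\<And>s. c s \<in> SO"
     "c 0 = mat 1" "\<And>s. (2 * s) *\<^sub>R c' s = c s ** c s - mat 1"
     "\<And>s. c s ** (mat 1 - s *\<^sub>R A) = mat 1 + s *\<^sub>R A"
proof -
  obtain Q where QM: "\<And>s. Q s ** (mat 1 - s *\<^sub>R A) = mat 1" and MQ: "\<And>s. (mat 1 - s *\<^sub>R A) ** Q s = mat 1"
    and Q': "\<And>s. (Q has_vector_derivative (Q s ** A ** Q s)) (at s)" and cont: "continuous_on UNIV Q"
    using skew_resolvent[OF A] by metis
  define c where "c = (\<lambda>s. 2 *\<^sub>R Q s - mat 1)"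
  define c' where "c' = (\<lambda>s. 2 *\<^sub>R (Q s ** A ** Q s))"
  have 1: "(c has_vector_derivative c' s) (at s)" for s
    unfolding c_def c'_def by (auto intro!: derivative_eq_intros Q')
  have 2: "continuous_on UNIV c'"
    unfolding c'_def by (intro continuous_intros matmul.continuous_on cont)
  have 3: "c s ** (mat 1 - s *\<^sub>R A) = mat 1 + s *\<^sub>R A" for s
    by (simp add: c_def matmul.diff_left matmul.scaleR_left QM) (simp add: vec_eq_iff)
  have 4: "c 0 = mat 1" using QM[of 0] by (simp add: c_def) (simp add: vec_eq_iff)
  have 5: "(2 * s) *\<^sub>R c' s = c s ** c s - mat 1" for s
  proof -
    have "s *\<^sub>R (A ** Q s) = Q s - mat 1"
      using MQ[of s] by (simp add: matmul.diff_left matmul.scaleR_left algebra_simps)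
    then have "s *\<^sub>R (Q s ** A ** Q s) = Q s ** Q s - Q s"
      by (metis matmul.scaleR_right matrix_mul_assoc matmul.diff_right matrix_mul_rid)
    then have "(4 * s) *\<^sub>R (Q s ** A ** Q s) = 4 *\<^sub>R (Q s ** Q s - Q s)"
      by (metis scaleR_scaleR)
    then show ?thesis
      by (simp add: c_def c'_def matmul.diff_left matmul.diff_right matmul.scaleR_left matmul.scaleR_right
         vec_eq_iff algebra_simps)
  qed
  have 6: "c s \<in> SO" for s
  proof -
    let ?P = "mat 1 + s *\<^sub>R A"
    have T: "transpose (mat 1 - s *\<^sub>R A) = ?P"
      by (simp add: transpose_minus transpose_scalar A)
    then have QP: "transpose (Q s) ** ?P = mat 1"
      using MQ[of s] by (metis matrix_transpose_mul transpose_mat)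
    \<comment> \<open>Sandwiching \<open>(1 + s A) + (1 - s A) = 2\<close> yields
      \<open>2 Q^T Q = Q + Q^T\<close>, which is orthogonality of \<open>2 Q - 1\<close>.\<close>
    have *: "transpose (Q s) ** (?P + (mat 1 - s *\<^sub>R A)) ** Q s = Q s + transpose (Q s)"
    proof -
      have "transpose (Q s) ** (?P + (mat 1 - s *\<^sub>R A)) ** Q s =
          (transpose (Q s) ** ?P) ** Q s + transpose (Q s) ** ((mat 1 - s *\<^sub>R A) ** Q s)"
        by (simp only: matmul.add_left matmul.add_right matrix_mul_assoc)
      then show ?thesis by (simp only: QP MQ matrix_mul_lid matrix_mul_rid)
    qed
    have "2 *\<^sub>R (transpose (Q s) ** Q s) = Q s + transpose (Q s)"
    proof -
      have "?P + (mat 1 - s *\<^sub>R A) = 2 *\<^sub>R mat 1" by (simp add: vec_eq_iff)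
      with * show ?thesis by (simp only: matmul.scaleR_right matmul.scaleR_left matrix_mul_rid)
    qed
    then have "orthogonal_matrix (c s)"
      unfolding orthogonal_matrix
      by (simp add: c_def transpose_minus transpose_scalar matmul.diff_left matmul.diff_right
         matmul.scaleR_left matmul.scaleR_right)
    moreover have "det (c s) = 1"
    proof -
      \<comment> \<open>The two factors of the Cayley transform are transposes of each other, so
        their determinants cancel.\<close>
      have "det (mat 1 - s *\<^sub>R A) = det ?P" by (metis T det_transpose)
      moreover have "det (c s) * det (mat 1 - s *\<^sub>R A) = det ?P" by (metis 3 det_mul)
      moreover have "det (Q s) * det (mat 1 - s *\<^sub>R A) = 1" by (metis QM det_mul det_I)
      ultimately show ?thesis by (metis mult_cancel_right1 mult_zero_right zero_neq_one)
    qed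
    ultimately show ?thesis by (simp add: SO_def rotation_matrix_def)
  qed
  show ?thesis using that 1 2 3 4 5 6 by blast
qed

text \<open>The inverse Cayley transform \<open>A = (R - 1) (R + 1)^{-1}\<close>; the absence of the
  eigenvalue -1 makes \<open>R + 1\<close> invertible.\<close>

lemma orthogonal_eq_cayley:
  fixes R :: "real^'n^'n"
  assumes R: "orthogonal_matrix R" and inj: "\<And>x. R *v x = - x \<Longrightarrow> x = 0"
  obtains A where "transpose A = - A" "R ** (mat 1 - A) = mat 1 + A"
proof -
  have "\<exists>W. W ** (R + mat 1) = mat 1"
    unfolding matrix_left_invertible_ker
    by (auto simp: matrix_vector_mult_add_rdistrib intro!: inj) (simp add: eq_neg_iff_add_eq_0)
  then obtain W where W: "W ** (R + mat 1) = mat 1" by blast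
  then have W': "(R + mat 1) ** W = mat 1" by (simp add: matrix_left_right_inverse)
  have T1: "transpose W ** (transpose R + mat 1) = mat 1"
    using W' by (metis matrix_transpose_mul transpose_mat transpose_plus)
  have RT: "transpose R ** R = mat 1" using R by (simp add: orthogonal_matrix)
  define A where "A = (R - mat 1) ** W"
  have comm: "(R + mat 1) ** A = R - mat 1"
  proof -
    have "(R + mat 1) ** (R - mat 1) = (R - mat 1) ** (R + mat 1)"
      by (simp add: matmul.add_left matmul.add_right matmul.diff_left matmul.diff_right)
    then show ?thesis unfolding A_def by (metis W' matrix_mul_assoc matrix_mul_rid)
  qed
  then have "R ** (mat 1 - A) = mat 1 + A"
    by (simp add: matmul.add_left matmul.diff_right algebra_simps)
  moreover have "transpose A = - A"
  proof -
    have "transpose A = transpose W ** (transpose R - mat 1)"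
      by (simp add: A_def matrix_transpose_mul transpose_minus)
    also have "\<dots> = transpose W ** ((transpose R - mat 1) ** (R + mat 1)) ** W"
      by (metis W' matrix_mul_assoc matrix_mul_rid)
    also have "(transpose R - mat 1) ** (R + mat 1) = - ((transpose R + mat 1) ** (R - mat 1))"
      by (simp add: matmul.add_left matmul.add_right matmul.diff_left matmul.diff_right RT)
    also have "transpose W ** \<dots> ** W = - (transpose W ** (transpose R + mat 1) ** ((R - mat 1) ** W))"
      by (simp add: matmul.minus_left matmul.minus_right matrix_mul_assoc)
    also have "\<dots> = - A" by (simp add: T1 A_def)
    finally show ?thesis .
  qed
  ultimately show ?thesis using that by blast
qed

section \<open>Bounding the geodesic distance by the chord\<close>

lemma trace_eq_CARD_imp:
  fixes R :: "real^'n^'n"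
  assumes "orthogonal_matrix R" "trace R = real CARD('n)"
  shows "R = mat 1"
  using norm_orthogonal_minus_mat_1[OF assms(1)] assms(2) by simp

lemma trace_orthogonal_le:
  fixes R :: "real^'n^'n"
  assumes "orthogonal_matrix R"
  shows "trace R \<le> real CARD('n)"
proof -
  have "0 \<le> 2 * (real CARD('n) - trace R)"
    unfolding norm_orthogonal_minus_mat_1[OF assms, symmetric] by simp
  then show ?thesis by simp
qed

text \<open>The Cayley curve is not a geodesic, but its speed is at most the derivative of
  \<open>arccos (1 - D/2)\<close> along it, where \<open>D\<close> is the squared chord length:
  this is what \<open>orthogonal_trace_square_le\<close> says for the points of the curve.\<close>
lemma curve_length_le_arccos:
  fixes R :: "real^'n^'n"
  assumes R: "orthogonal_matrix R" and small: "real CARD('n) - trace R < 2"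
  obtains L where "L \<in> curve_lengths (mat 1) R" "L \<le> arccos (1 - (real CARD('n) - trace R) / 2)"
proof -
  \<comment> \<open>An eigenvector for -1 would be displaced by twice its length, too far for
    \<open>orthogonal_displacement_le\<close>.\<close>
  have "R *v x = - x \<Longrightarrow> x = 0" for x
  proof -
    assume x: "R *v x = - x"
    have "(norm (R *v x - x))^2 = 4 * (norm x)^2"
    proof -
      have "R *v x - x = - (2 *\<^sub>R x)" unfolding x by (simp add: vec_eq_iff)
      then show ?thesis by (simp add: power_mult_distrib)
    qed
    then have "8 * (norm x)^2 \<le> (norm (R - mat 1))^2 * (norm x)^2"
      using orthogonal_displacement_le[OF R, of x] norm_orthogonal_minus_mat_1[OF R] small by simp
    moreover have "(norm (R - mat 1))^2 * (norm x)^2 \<le> 4 * (norm x)^2"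
      using norm_orthogonal_minus_mat_1[OF R] small by (intro mult_right_mono) auto
    ultimately have "8 * (norm x)^2 \<le> 4 * (norm x)^2" by (rule order_trans)
    then show "x = 0" by simp
  qed
  then obtain A where A: "transpose A = - A" and RA: "R ** (mat 1 - A) = mat 1 + A"
    using orthogonal_eq_cayley[OF R] by metis
  obtain c c' where c': "\<And>s. (c has_vector_derivative c' s) (at s)" and cont': "continuous_on UNIV c'"
    and SO: "\<And>s. c s \<in> SO" and c0: "c 0 = mat 1" and ode: "\<And>s. (2 * s) *\<^sub>R c' s = c s ** c s - mat 1"
    and cA: "\<And>s. c s ** (mat 1 - s *\<^sub>R A) = mat 1 + s *\<^sub>R A"
    using cayley_curve[OF A] by metis
  have orth: "orthogonal_matrix (c s)" for s using SO[of s] by (simp add: SO_def rotation_matrix_def)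
  have c1: "c 1 = R"
  proof -
    obtain Q where "(mat 1 - A) ** Q = mat 1"
      using skew_resolvent[OF A] by (metis scaleR_one)
    moreover have "c 1 ** (mat 1 - A) = R ** (mat 1 - A)" using cA[of 1] RA by simp
    ultimately show ?thesis by (metis matrix_mul_assoc matrix_mul_rid)
  qed
  define v where "v = (\<lambda>s. mat_norm (c' s))"
  have contv: "continuous_on {0..1} v"
    unfolding v_def mat_norm_eq by (intro continuous_intros continuous_on_subset[OF cont']) auto
  have L: "integral {0..1} v \<in> curve_lengths (mat 1) R"
    using curve_lengths_C1[of c c', OF c' cont' SO] unfolding c0 c1 v_def .
  show ?thesis
  proof (cases "A = 0")
    \<comment> \<open>Here the chord vanishes and the quotient by \<open>w\<close> used below would
      degenerate; the constant curve of length 0 serves.\<close>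
    case True
    have "R = mat 1" using RA by (simp add: True)
    moreover have "0 \<in> curve_lengths (mat 1) (mat 1 :: real^'n^'n)"
      using curve_lengths_C1[of "\<lambda>_. mat 1 :: real^'n^'n" "\<lambda>_. 0"] SO[of 0] c0 by (simp add: mat_norm_eq)
    ultimately show ?thesis using that[of 0] by (simp add: mat_norm_eq trace_I)
  next
    case False
    define D where "D = (\<lambda>s. real CARD('n) - trace (c s))"
    define E where "E = (\<lambda>s. real CARD('n) - trace (c s ** c s))"
    define D' where "D' = (\<lambda>s. - trace (c' s))"
    have dD: "(D has_real_derivative D' s) (at s)" for s
    proof -
      have "((\<lambda>s. mat 1 \<bullet> c s) has_vector_derivative mat 1 \<bullet> c' s) (at s)"
        by (rule bounded_linear.has_vector_derivative[OF bounded_linear_inner_right c'])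
      then show ?thesis unfolding D_def D'_def
        by (auto simp: inner_mat_1 has_real_derivative_iff_has_vector_derivative intro!: derivative_eq_intros)
    qed
    have contD: "continuous_on S D" for S
      using dD DERIV_isCont by (intro continuous_at_imp_continuous_on) blast
    have orth2: "orthogonal_matrix (c s ** c s)" for s by (intro orthogonal_matrix_mul orth)
    have E0: "E s \<ge> 0" for s using trace_orthogonal_le[OF orth2, of s] by (simp add: E_def)
    have v2: "(2 * s)^2 * (v s)^2 = E s" for s
    proof -
      have "(2 * s)^2 * (v s)^2 = (mat_norm (c s ** c s - mat 1))^2"
        by (simp add: v_def mat_norm_power2 power_mult_distrib flip: ode)
      then show ?thesis by (simp add: mat_norm_power2 norm_orthogonal_minus_mat_1[OF orth2] E_def)
    qed
    have D'E: "2 * s * D' s = E s" for s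
    proof -
      have "mat 1 \<bullet> ((2 * s) *\<^sub>R c' s) = mat 1 \<bullet> (c s ** c s) - mat 1 \<bullet> (mat 1 :: real^'n^'n)"
        unfolding ode by (simp add: inner_diff_right)
      then show ?thesis by (simp add: inner_mat_1 D'_def E_def trace_I)
    qed
    have D'0: "D' s \<ge> 0" if "s > 0" for s
      using D'E[of s] E0[of s] that by (smt (verit) mult_pos_neg)
    \<comment> \<open>The chord grows along the curve, so smallness at the endpoint \<open>R\<close>
      holds throughout and the trace inequality applies at every point.\<close>
    have D2: "D s < 2" if "s \<in> {0..1}" for s
    proof -
      have "D s \<le> D 1"
      proof (rule DERIV_nonneg_imp_increasing_open[of s 1 D])
        show "s \<le> 1" using that by simp
        show "\<exists>y. (D has_real_derivative y) (at x) \<and> 0 \<le> y" if "s < x" for x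
          using that \<open>s \<in> {0..1}\<close> dD[of x] D'0[of x] by auto
      qed (rule contD)
      then show ?thesis using small by (simp add: D_def c1)
    qed
    have D0: "D s > 0" if "s > 0" for s
    proof -
      have "c s \<noteq> mat 1"
      proof
        assume "c s = mat 1"
        then have "mat 1 - s *\<^sub>R A = mat 1 + s *\<^sub>R A" using cA[of s] by simp
        then have "2 *\<^sub>R s *\<^sub>R A = 0" by (simp add: vec_eq_iff)
        with False that show False by simp
      qed
      then show ?thesis
        using trace_eq_CARD_imp[OF orth] trace_orthogonal_le[OF orth, of s] by (force simp: D_def)
    qed
    define G where "G = (\<lambda>s. arccos (1 - D s / 2))"
    \<comment> \<open>\<open>w\<close> is the sine of the angle \<open>G\<close>, so
      \<open>4 * (w s)^2 = D s * (4 - D s)\<close>.\<close>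
    define w where "w = (\<lambda>s. sqrt (1 - (1 - D s / 2)^2))"
    have w2: "(w s)^2 = D s - (D s)^2 / 4" "w s > 0" if "s \<in> {0<..<1}" for s
    proof -
      have "D s > 0" "D s < 2" using D0[of s] D2[of s] that by auto
      then have "1 - (1 - D s / 2)^2 > 0" by (simp add: abs_square_less_1)
      then show "(w s)^2 = D s - (D s)^2 / 4" "w s > 0"
        unfolding w_def by (auto simp: power2_eq_square algebra_simps)
    qed
    have dG: "(G has_real_derivative (D' s / 2) / w s) (at s)" if "s \<in> {0<..<1}" for s
    proof -
      have "D s > 0" "D s < 2" using D0[of s] D2[of s] that by auto
      then have "DERIV arccos (1 - D s / 2) :> inverse (- sqrt (1 - (1 - D s / 2)^2))"
        by (intro DERIV_arccos) auto
      then have "(G has_real_derivative inverse (- sqrt (1 - (1 - D s / 2)^2)) * (- (D' s / 2))) (at s)"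
        unfolding G_def by (rule DERIV_chain2) (auto intro!: derivative_eq_intros dD)
      then show ?thesis by (simp add: w_def field_simps)
    qed
    have Dge0: "D s \<ge> 0" for s using trace_orthogonal_le[OF orth, of s] by (simp add: D_def)
    have "continuous_on {0..1} G"
      unfolding G_def
    proof (rule continuous_on_arccos)
      show "continuous_on {0..1} (\<lambda>s. 1 - D s / 2)" by (intro continuous_intros contD) auto
      show "\<forall>s\<in>{0..1}. - 1 \<le> 1 - D s / 2 \<and> 1 - D s / 2 \<le> 1" using Dge0 D2 by (force simp: less_imp_le)
    qed
    \<comment> \<open>\<open>arccos\<close> is not differentiable at 1, the value reached at
      \<open>s = 0\<close>; continuity of \<open>G\<close> on the closed interval and its derivative
      inside suffice.\<close>
    then have "((\<lambda>s. (D' s / 2) / w s) has_integral G 1 - G 0) {0..1}"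
      using dG by (intro fundamental_theorem_of_calculus_interior)
        (auto simp: has_real_derivative_iff_has_vector_derivative)
    moreover have "(v has_integral integral {0..1} v) {0..1}"
      by (intro integrable_integral integrable_continuous_interval contv)
    moreover have "v s \<le> (D' s / 2) / w s" if s: "s \<in> {0<..<1}" for s
    proof -
      have "D s * (4 - D s) \<le> E s"
        unfolding D_def E_def using D2[of s] s by (intro orthogonal_trace_square_le orth) (simp add: D_def)
      then have wE: "4 * (w s)^2 \<le> E s" using w2(1)[OF s] by (simp add: power2_eq_square algebra_simps)
      \<comment> \<open>\<open>v2\<close> and \<open>D'E\<close> express both speed and derivative
        through \<open>E\<close>, so that \<open>4 * (w s)^2 \<le> E s\<close> compares
        them.\<close>
      have "(2 * s)^2 * (4 * (v s * w s)^2) = E s * (4 * (w s)^2)"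
        by (simp add: power_mult_distrib flip: v2)
      also have "\<dots> \<le> E s * E s" by (intro mult_left_mono wE E0)
      also have "\<dots> = (2 * s)^2 * (D' s)^2" by (simp add: power2_eq_square flip: D'E)
      finally have "4 * (v s * w s)^2 \<le> (D' s)^2" using s by simp
      then have "(v s * w s)^2 \<le> (D' s / 2)^2" by (simp add: power_divide)
      then have "v s * w s \<le> D' s / 2" by (rule power2_le_imp_le) (use D'0[of s] s in simp)
      then show ?thesis using w2(2)[OF s] by (simp add: pos_le_divide_eq)
    qed
    ultimately have "integral {0..1} v \<le> G 1 - G 0"
      unfolding has_integral_Icc_iff_Ioo by (metis (no_types, lifting) has_integral_le)
    moreover have "G 0 = 0" by (simp add: G_def D_def c0 trace_I)
    ultimately show ?thesis using that[OF L] by (simp add: G_def D_def c1)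
  qed
qed

subsection \<open>Connectedness of the rotation group\<close>

text \<open>The Householder reflection in the hyperplane orthogonal to \<open>u\<close>, with the
  matrix \<open>u u^T\<close> written out by entries.\<close>

definition reflection :: "real^'n \<Rightarrow> real^'n^'n" where
  "reflection u = mat 1 - (2 / (u \<bullet> u)) *\<^sub>R (\<chi> i j. u $ i * u $ j)"

lemma outer_vec: "(\<chi> i j. u $ i * w $ j) *v x = (w \<bullet> x) *\<^sub>R u" for u w x :: "real^'n"
  by (simp add: vec_eq_iff matrix_vector_mult_def inner_vec_def sum_distrib_left mult_ac)

lemma reflection_vec: "reflection u *v x = x - (2 * (u \<bullet> x) / (u \<bullet> u)) *\<^sub>R u"
  by (simp add: reflection_def matrix_vector_mult_diff_rdistrib outer_vec flip: scaleR_matrix_vector_assoc)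

lemma reflection_scaleR: "k \<noteq> 0 \<Longrightarrow> reflection (k *\<^sub>R u) = reflection u"
  by (simp add: matrix_eq reflection_vec)

lemma reflection_involution:
  assumes "u \<noteq> 0" shows "reflection u ** reflection u = mat 1"
  using assms by (simp add: matrix_eq reflection_vec inner_diff_right vec_eq_iff flip: matrix_vector_mul_assoc)

lemma orthogonal_matrix_reflection:
  assumes "u \<noteq> 0" shows "orthogonal_matrix (reflection u)"
proof -
  have "transpose (reflection u) = reflection u"
    by (simp add: reflection_def transpose_minus transpose_scalar) (simp add: transpose_def mult_ac)
  with reflection_involution[OF assms] show ?thesis by (simp add: orthogonal_matrix)
qed

text \<open>Along a coordinate vector the reflection is diagonal. This one determinant is enough to
  exclude the wrong starting point in \<open>curve_lengths_nonempty\<close>.\<close>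

lemma det_reflection_axis: "det (reflection (axis k 1 :: real^'n)) = - 1"
proof -
  have "reflection (axis k 1 :: real^'n) $ i $ j = (if i = j then (if i = k then - 1 else 1) else 0)" for i j :: 'n
    unfolding reflection_def inner_axis_axis by (auto simp: mat_def axis_def)
  then have "det (reflection (axis k 1 :: real^'n)) = (\<Prod>i\<in>UNIV. if i = k then - 1 else (1::real))"
    by (subst det_diagonal) auto
  then show ?thesis by simp
qed

lemma C1_differentiable_on_matmul:
  fixes f g :: "real \<Rightarrow> real^'n^'n"
  assumes "f C1_differentiable_on S" "g C1_differentiable_on S"
  shows "(\<lambda>t. f t ** g t) C1_differentiable_on S"
proof -
  from assms obtain f' g' where "\<And>t. t \<in> S \<Longrightarrow> (f has_vector_derivative f' t) (at t)"
    "\<And>t. t \<in> S \<Longrightarrow> (g has_vector_derivative g' t) (at t)" and cont: "continuous_on S f'" "continuous_on S g'"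
    unfolding C1_differentiable_on_def by metis
  moreover from this have "continuous_on S f" "continuous_on S g"
    by (meson continuous_at_imp_continuous_on has_vector_derivative_continuous)+
  ultimately show ?thesis unfolding C1_differentiable_on_def
    by (intro exI[of _ "\<lambda>t. f t ** g' t + f' t ** g t"])
      (auto intro!: matmul.has_vector_derivative continuous_intros matmul.continuous_on)
qed

text \<open>Move the vector along the line through \<open>e\<close> and \<open>u\<close>. The line
  misses 0 unless the vectors are parallel, and then both reflections coincide.\<close>

lemma reflection_curve:
  fixes e u :: "real^'n"
  assumes "e \<noteq> 0" "u \<noteq> 0"
  obtains c where "c C1_differentiable_on UNIV" "\<And>t. orthogonal_matrix (c t)"
    "c 0 = reflection e" "c 1 = reflection u"
proof (cases "\<exists>k. u = k *\<^sub>R e")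
  case True
  with assms have "reflection u = reflection e" using reflection_scaleR by force
  then show ?thesis
    by (intro that[of "\<lambda>_. reflection e"] orthogonal_matrix_reflection C1_differentiable_on_const assms) simp_all
next
  case False
  define d where "d = u - e"
  define w where "w = (\<lambda>t. e + t *\<^sub>R d)"
  have w0: "w t \<noteq> 0" for t
  proof
    assume "w t = 0"
    then have "t *\<^sub>R u = (t - 1) *\<^sub>R e" by (simp add: w_def d_def algebra_simps)
    moreover from this have "t \<noteq> 0" using assms by auto
    ultimately have "u = ((t - 1) / t) *\<^sub>R e" by (metis (no_types) divide_inverse_commute scaleR_scaleR left_inverse scaleR_one)
    with False show False by blast
  qed
  have ww: "w t \<bullet> w t = e \<bullet> e + t * (2 * (e \<bullet> d)) + t * t * (d \<bullet> d)" for t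
    by (simp add: w_def inner_add_left inner_add_right inner_commute[of d e] algebra_simps)
  have outer: "(\<chi> i j. w t $ i * w t $ j) = (\<chi> i j. e $ i * e $ j) + t *\<^sub>R (\<chi> i j. e $ i * d $ j + d $ i * e $ j)
      + (t * t) *\<^sub>R (\<chi> i j. d $ i * d $ j)" for t
    by (simp add: w_def vec_eq_iff algebra_simps)
  have "(\<lambda>t. w t \<bullet> w t) C1_differentiable_on UNIV"
    unfolding ww by (intro C1_differentiable_on_add C1_differentiable_on_mult) auto
  then obtain q' where q': "\<And>t. ((\<lambda>t. w t \<bullet> w t) has_vector_derivative q' t) (at t)" "continuous_on UNIV q'"
    unfolding C1_differentiable_on_def by blast
  have "(\<lambda>t. 2 / (w t \<bullet> w t)) C1_differentiable_on UNIV"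
    unfolding C1_differentiable_on_def
  proof (intro exI[of _ "\<lambda>t. - 2 * q' t / (w t \<bullet> w t)^2"] conjI ballI)
    show "((\<lambda>t. 2 / (w t \<bullet> w t)) has_vector_derivative - 2 * q' t / (w t \<bullet> w t)^2) (at t)" for t
      using q'(1)[of t] w0[of t] unfolding has_real_derivative_iff_has_vector_derivative[symmetric]
      by (auto intro!: derivative_eq_intros simp: power2_eq_square)
    have "continuous_on UNIV w" unfolding w_def by (intro continuous_intros)
    then show "continuous_on UNIV (\<lambda>t. - 2 * q' t / (w t \<bullet> w t)^2)"
      using w0 by (intro continuous_intros q'(2)) auto
  qed
  then have "(\<lambda>t. reflection (w t)) C1_differentiable_on UNIV"
    unfolding reflection_def outer
    by (intro C1_differentiable_on_diff C1_differentiable_on_scaleR C1_differentiable_on_add C1_differentiable_on_mult) auto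
  then show ?thesis using that[of "\<lambda>t. reflection (w t)"] w0 orthogonal_matrix_reflection
    by (auto simp: w_def d_def)
qed

text \<open>Induction on the codimension of the space of fixed vectors: composing \<open>R\<close> with the
  reflection along \<open>R x - x\<close> fixes \<open>x\<close> and everything that \<open>R\<close> fixes.\<close>
lemma orthogonal_curve:
  fixes R :: "real^'n^'n" and e :: "real^'n"
  assumes "orthogonal_matrix R" "e \<noteq> 0"
  shows "\<exists>c. c C1_differentiable_on UNIV \<and> (\<forall>t. orthogonal_matrix (c t)) \<and>
    (c 0 = mat 1 \<or> c 0 = reflection e) \<and> c 1 = R"
  using assms(1)
proof (induction "CARD('n) - dim {x. R *v x = x}" arbitrary: R rule: less_induct)
  case less
  have RR: "(R *v a) \<bullet> (R *v b) = a \<bullet> b" for a b by (rule orthogonal_matrix_inner[OF less.prems])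
  show ?case
  proof (cases "\<forall>x. R *v x = x")
    case True
    then have "R = mat 1" by (simp add: matrix_eq)
    then show ?thesis using orthogonal_matrix_id by (intro exI[of _ "\<lambda>_. mat 1"]) auto
  next
    case False
    then obtain x where x: "R *v x \<noteq> x" by blast
    define u where "u = R *v x - x"
    have u: "u \<noteq> 0" using x by (simp add: u_def)
    define R' where "R' = reflection u ** R"
    have sub: "subspace {y. S *v y = y}" for S :: "real^'n^'n"
      by (auto simp: subspace_def matrix_vector_right_distrib matrix_vector_mult_scaleR)
    \<comment> \<open>Because \<open>R\<close> preserves norms, reflecting \<open>R *v x\<close>
      along \<open>u\<close> subtracts exactly \<open>u\<close> and returns
      \<open>x\<close>.\<close>
    have "u \<bullet> u = 2 * (u \<bullet> (R *v x))"
      by (simp add: u_def inner_diff_left inner_diff_right RR inner_commute)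
    then have "R' *v x = R *v x - u"
      using u inner_eq_zero_iff[of u] by (simp add: R'_def reflection_vec flip: matrix_vector_mul_assoc)
    then have R'x: "R' *v x = x" by (simp add: u_def)
    have "R' *v y = y" if "R *v y = y" for y
    proof -
      have "u \<bullet> y = 0" using RR[of x y] that by (simp add: u_def inner_diff_left)
      then show ?thesis using that by (simp add: R'_def reflection_vec flip: matrix_vector_mul_assoc)
    qed
    then have "{y. R *v y = y} \<subset> {y. R' *v y = y}" using R'x x by blast
    then have "dim {y. R *v y = y} < dim {y. R' *v y = y}"
      using sub by (intro dim_psubset) (simp add: span_eq_iff[THEN iffD2])
    moreover have "dim {y. R' *v y = y} \<le> CARD('n)"
      using dim_subset_UNIV[of "{y. R' *v y = y}"] by simp
    ultimately have lt: "CARD('n) - dim {y. R' *v y = y} < CARD('n) - dim {y. R *v y = y}" by linarith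
    have "orthogonal_matrix R'"
      unfolding R'_def by (intro orthogonal_matrix_mul orthogonal_matrix_reflection u less.prems)
    from less.hyps[OF lt this] obtain c where c: "c C1_differentiable_on UNIV" "\<And>t. orthogonal_matrix (c t)"
      "c 0 = mat 1 \<or> c 0 = reflection e" "c 1 = R'"
      by blast
    obtain h where h: "h C1_differentiable_on UNIV" "\<And>t. orthogonal_matrix (h t)"
      "h 0 = reflection e" "h 1 = reflection u"
      using reflection_curve[OF assms(2) u] by blast
    have "h 1 ** c 1 = R"
      using reflection_involution[OF u] by (simp add: h(4) c(4) R'_def matrix_mul_assoc)
    \<comment> \<open>A reflection is its own inverse, so the product of the starting points is
      again one of the two admissible ones.\<close>
    moreover have "h 0 ** c 0 = mat 1 \<or> h 0 ** c 0 = reflection e"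
      using c(3) h(3) reflection_involution[OF assms(2)] by auto
    ultimately show ?thesis
      using C1_differentiable_on_matmul[OF h(1) c(1)] h(2) c(2) orthogonal_matrix_mul
      by (intro exI[of _ "\<lambda>t. h t ** c t"]) auto
  qed
qed

text \<open>Along a curve of orthogonal matrices the determinant is continuous with values in -1 and
  1, hence constant. A curve ending in \<open>SO\<close> therefore stays in \<open>SO\<close> and
  cannot start at a reflection.\<close>

lemma curve_lengths_nonempty:
  fixes R :: "real^'n^'n"
  assumes "R \<in> SO"
  shows "curve_lengths (mat 1) R \<noteq> {}"
proof -
  obtain k :: 'n where True by blast
  define e :: "real^'n" where "e = axis k 1"
  have R: "orthogonal_matrix R" "det R = 1" using assms by (auto simp: SO_def rotation_matrix_def)
  obtain c where c: "c C1_differentiable_on UNIV" "\<And>t. orthogonal_matrix (c t)"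
    "c 0 = mat 1 \<or> c 0 = reflection e" "c 1 = R"
    using orthogonal_curve[OF R(1), of e] by (auto simp: e_def)
  then obtain c' where c': "\<And>t. (c has_vector_derivative c' t) (at t)" "continuous_on UNIV c'"
    unfolding C1_differentiable_on_def by blast
  have "continuous_on UNIV c"
    using c'(1) by (meson continuous_at_imp_continuous_on has_vector_derivative_continuous)
  then have contd: "continuous_on UNIV (\<lambda>t. det (c t))"
    unfolding det_def by (intro continuous_intros)
  have d1: "det (c t) = 1" for t
  proof (rule ccontr)
    assume "det (c t) \<noteq> 1"
    then have "det (c t) = - 1" using det_orthogonal_matrix[OF c(2)] by blast
    have "connected (range (\<lambda>t. det (c t)))" using contd by (rule connected_continuous_image) simp
    moreover have "- 1 \<in> range (\<lambda>t. det (c t))" "1 \<in> range (\<lambda>t. det (c t))"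
      using R(2) c(4) \<open>det (c t) = - 1\<close> by (metis rangeI)+
    ultimately have "{- 1..1} \<subseteq> range (\<lambda>t. det (c t))" by (rule connected_contains_Icc)
    then have "0 \<in> range (\<lambda>t. det (c t))" by auto
    then obtain s where "det (c s) = 0" by auto
    then show False using det_orthogonal_matrix[OF c(2)[of s]] by simp
  qed
  have "c 0 \<noteq> reflection e" using det_reflection_axis[of k] d1[of 0] by (metis e_def neg_equal_iff_equal one_neq_neg_one)
  then have "c 0 = mat 1" using c(3) by blast
  then show ?thesis
    using curve_lengths_C1[of c c'] c' c(2,4) d1 by (auto simp: SO_def rotation_matrix_def)
qed

subsection \<open>The Winfree dynamics\<close>

text \<open>Since \<open>R\<close> preserves norms, \<open>x \<bullet> (R *v x)\<close> is
  \<open>x \<bullet> x\<close> minus half of the squared displacement, which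
  \<open>orthogonal_displacement_le\<close> controls.\<close>

lemma orthogonal_inner_ge:
  fixes R :: "real^'n^'n"
  assumes R: "orthogonal_matrix R" and D: "real CARD('n) - trace R \<le> D" "D < 2"
  shows "(1 - D / 2) * (x \<bullet> x) \<le> x \<bullet> (R *v x)"
proof -
  have "2 * (norm (R *v x - x))^2 \<le> (2 * (real CARD('n) - trace R)) * (norm x)^2"
    using orthogonal_displacement_le[OF R, of x] D unfolding norm_orthogonal_minus_mat_1[OF R] by simp
  also have "\<dots> \<le> (2 * D) * (norm x)^2" using D by (intro mult_right_mono) auto
  finally have "(norm (R *v x - x))^2 \<le> D * (x \<bullet> x)" by (simp add: power2_norm_eq_inner)
  moreover have "(norm (R *v x - x))^2 = 2 * (x \<bullet> x) - 2 * (x \<bullet> (R *v x))"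
    by (simp add: power2_norm_eq_inner inner_diff_left inner_diff_right
      orthogonal_matrix_inner[OF R] inner_commute)
  ultimately show ?thesis by (simp add: algebra_simps)
qed

lemma orthogonal_matrix_inner_ge:
  fixes R X :: "real^'n^'n"
  assumes "orthogonal_matrix R" "real CARD('n) - trace R \<le> D" "D < 2"
  shows "(1 - D / 2) * (X \<bullet> X) \<le> X \<bullet> (R ** X)" "(1 - D / 2) * (X \<bullet> X) \<le> X \<bullet> (X ** R)"
proof -
  have *: "(1 - D / 2) * (Y \<bullet> Y) \<le> Y \<bullet> (S ** Y)"
    if "orthogonal_matrix S" "trace S = trace R" for S Y :: "real^'n^'n"
    unfolding inner_columns[of Y] column_mult sum_distrib_left
    using that assms by (intro sum_mono orthogonal_inner_ge) auto
  show "(1 - D / 2) * (X \<bullet> X) \<le> X \<bullet> (R ** X)" using * assms by blast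
  have "trace (transpose R) = trace R" by (simp add: trace_def transpose_def)
  then have "(1 - D / 2) * (transpose X \<bullet> transpose X) \<le> transpose X \<bullet> (transpose R ** transpose X)"
    using assms by (intro *) auto
  then show "(1 - D / 2) * (X \<bullet> X) \<le> X \<bullet> (X ** R)"
    by (simp add: inner_transpose flip: matrix_transpose_mul)
qed

text \<open>Each of the four terms in the symmetrised difference of squares contributes at least
  \<open>1 - D / 2\<close>; the factor 2 on the left halves their sum.\<close>

lemma orthogonal_square_inner_ge:
  fixes P Q :: "real^'n^'n"
  assumes "orthogonal_matrix P" "real CARD('n) - trace P \<le> D"
    and "orthogonal_matrix Q" "real CARD('n) - trace Q \<le> D" and "D < 2"
  shows "(2 - D) * ((P - Q) \<bullet> (P - Q)) \<le> (P - Q) \<bullet> (P ** P - Q ** Q)"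
proof -
  let ?X = "P - Q"
  have "2 *\<^sub>R (P ** P - Q ** Q) = P ** ?X + Q ** ?X + (?X ** P + ?X ** Q)"
    by (simp add: matmul.diff_left matmul.diff_right scaleR_2)
  then have "?X \<bullet> (2 *\<^sub>R (P ** P - Q ** Q)) = ?X \<bullet> (P ** ?X) + ?X \<bullet> (Q ** ?X) + (?X \<bullet> (?X ** P) + ?X \<bullet> (?X ** Q))"
    by (simp only: inner_add_right)
  then show ?thesis
    using orthogonal_matrix_inner_ge[OF assms(1,2,5), of ?X] orthogonal_matrix_inner_ge[OF assms(3,4,5), of ?X]
    by (simp add: algebra_simps)
qed

lemma skew_matrix_inner_eq_0:
  fixes \<Omega> X :: "real^'n^'n"
  assumes "\<Omega> \<in> so"
  shows "X \<bullet> (\<Omega> ** X) = 0"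
  using assms by (simp add: so_def inner_columns column_mult skew_inner_eq_0)

text \<open>Only the skew part of \<open>R\<close> pairs with \<open>\<Omega>\<close>;
  Cauchy-Schwarz then produces the norm of \<open>R - transpose R\<close>. The root contains the
  same quantity that drives the coupling term, so drift and coupling become comparable.\<close>

lemma trace_skew_mult_le:
  fixes \<Omega> R :: "real^'n^'n"
  assumes \<Omega>: "\<Omega> \<in> so" and R: "orthogonal_matrix R"
  shows "\<bar>trace (\<Omega> ** R)\<bar> \<le> mat_norm \<Omega> * sqrt (real CARD('n) - trace (R ** R))"
proof -
  have T: "transpose \<Omega> = - \<Omega>" using \<Omega> by (simp add: so_def)
  have "trace (\<Omega> ** R) = - (\<Omega> \<bullet> R)"
    by (simp add: inner_eq_trace T matmul.minus_left) (simp add: trace_def sum_negf)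
  moreover have "\<Omega> \<bullet> transpose R = - (\<Omega> \<bullet> R)"
    using inner_transpose[of \<Omega> R] by (simp add: T)
  ultimately have "2 * trace (\<Omega> ** R) = - (\<Omega> \<bullet> (R - transpose R))"
    by (simp add: inner_diff_right)
  then have 1: "2 * \<bar>trace (\<Omega> ** R)\<bar> \<le> norm \<Omega> * norm (R - transpose R)"
    using Cauchy_Schwarz_ineq2[of \<Omega> "R - transpose R"] by linarith
  have "R \<bullet> R = real CARD('n)"  "transpose R \<bullet> transpose R = real CARD('n)" "R \<bullet> transpose R = trace (R ** R)"
    using R inner_transpose[of "transpose R" R] by (simp_all add: inner_eq_trace orthogonal_matrix_def trace_I)
  then have "(norm (R - transpose R))^2 = 2 * (real CARD('n) - trace (R ** R))"
    by (simp add: power2_norm_eq_inner inner_diff_left inner_diff_right inner_commute)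
  then have "norm (R - transpose R) = sqrt 2 * sqrt (real CARD('n) - trace (R ** R))"
    by (metis norm_ge_zero real_sqrt_mult real_sqrt_unique)
  moreover have "norm \<Omega> = sqrt 2 * mat_norm \<Omega>" by (simp add: mat_norm_eq)
  ultimately have "2 * \<bar>trace (\<Omega> ** R)\<bar> \<le>
      (sqrt 2 * sqrt 2) * (mat_norm \<Omega> * sqrt (real CARD('n) - trace (R ** R)))"
    using 1 by (simp only: mult_ac)
  then show ?thesis by simp
qed

lemma geo_ball_imp_trace:
  fixes R :: "real^'n^'n"
  assumes "R \<in> geo_ball r"
  shows "real CARD('n) - trace R < r^2"
proof -
  from assms have R: "R \<in> SO" and d: "geo_dist (mat 1) R < r" by (auto simp: geo_ball_def)
  then have "orthogonal_matrix R" by (simp add: SO_def rotation_matrix_def)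
  then have "real CARD('n) - trace R = (mat_norm (R - mat 1))^2"
    by (simp add: mat_norm_power2 norm_orthogonal_minus_mat_1)
  moreover have "0 \<le> mat_norm (R - mat 1)" by (simp add: mat_norm_eq)
  moreover have "mat_norm (R - mat 1) < r"
    using mat_norm_le_geo_dist[OF curve_lengths_nonempty[OF R]] d by simp
  ultimately show ?thesis by (simp add: power_strict_mono)
qed

text \<open>Converts the chordal bound back into the geodesic one, in which the influence function
  is expressed.\<close>

lemma geo_dist_mat_1_le:
  fixes R :: "real^'n^'n"
  assumes "R \<in> SO" and D: "real CARD('n) - trace R \<le> D" "D < 2"
  shows "geo_dist (mat 1) R \<in> {0..arccos (1 - D / 2)}"
proof -
  have R: "orthogonal_matrix R" using assms by (simp add: SO_def rotation_matrix_def)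
  obtain L where "L \<in> curve_lengths (mat 1) R" "L \<le> arccos (1 - (real CARD('n) - trace R) / 2)"
    using curve_length_le_arccos[OF R] D by force
  moreover have "arccos (1 - (real CARD('n) - trace R) / 2) \<le> arccos (1 - D / 2)"
    using D trace_orthogonal_le[OF R] by (intro arccos_le_arccos) auto
  ultimately show ?thesis
    using geo_dist_le geo_dist_nonneg[OF curve_lengths_nonempty[OF assms(1)]] by force
qed

text \<open>At the first time some \<open>f k\<close> reaches \<open>b\<close>, all members are
  still at most \<open>b\<close>. The negative derivative then puts \<open>f k\<close> above
  \<open>b\<close> slightly earlier, a contradiction.\<close>

lemma barrier:
  fixes f :: "'i \<Rightarrow> real \<Rightarrow> real"
  assumes "finite I" and cont: "\<And>i. i \<in> I \<Longrightarrow> continuous_on {0..} (f i)"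
    and init: "\<And>i. i \<in> I \<Longrightarrow> f i 0 < b"
    and dec: "\<And>i t. \<lbrakk>i \<in> I; t > 0; f i t = b; \<forall>j\<in>I. f j t \<le> b\<rbrakk> \<Longrightarrow> \<exists>d<0. (f i has_real_derivative d) (at t)"
    and "i \<in> I" "t \<ge> 0"
  shows "f i t < b"
proof (rule ccontr)
  assume "\<not> f i t < b"
  \<comment> \<open>A finite union of closed sets, so the first contact time is attained.\<close>
  define S where "S = (\<Union>i\<in>I. {t\<in>{0..}. b \<le> f i t})"
  have "t \<in> S" using assms(5,6) \<open>\<not> f i t < b\<close> by (auto simp: S_def not_less intro!: bexI[of _ i])
  have "closed {t\<in>{0..}. b \<le> f i t}" if "i \<in> I" for i
    using continuous_on_closed_Collect_le[of "{0..}" "\<lambda>_. b" "f i"] cont[OF that] by simp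
  then have "closed S" unfolding S_def using \<open>finite I\<close> by blast
  have bdd: "bdd_below S" by (auto simp: S_def intro!: bdd_belowI[of _ 0])
  define T where "T = Inf S"
  have "T \<in> S" unfolding T_def using \<open>closed S\<close> bdd \<open>t \<in> S\<close> by (intro closed_contains_Inf) auto
  then obtain k where k: "k \<in> I" "T \<ge> 0" "b \<le> f k T" by (auto simp: S_def)
  have before: "f j s < b" if "j \<in> I" "0 \<le> s" "s < T" for j s
    using cInf_lower[OF _ bdd, of s] that unfolding T_def[symmetric] by (force simp: S_def)
  have "T > 0" using k init[of k] by (cases "T = 0") auto
  have le: "f j T \<le> b" if j: "j \<in> I" for j
  proof (rule ccontr)
    assume "\<not> f j T \<le> b"
    moreover have "continuous_on {0..T} (f j)" using cont[OF that] by (rule continuous_on_subset) auto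
    ultimately obtain s where "0 \<le> s" "s \<le> T" "f j s = b"
      using IVT'[of "f j" 0 b T] init[OF j] k(2) by force
    with before[OF that, of s] \<open>\<not> f j T \<le> b\<close> show False by (cases "s = T") auto
  qed
  obtain d where "d < 0" "(f k has_real_derivative d) (at T)"
    using dec[of k T] k le \<open>T > 0\<close> by force
  then obtain e where e: "e > 0" "\<And>h. 0 < h \<Longrightarrow> h < e \<Longrightarrow> f k T < f k (T - h)"
    using DERIV_neg_dec_left by blast
  define h where "h = min e T / 2"
  have "0 < h" "h < e" "h < T" using e \<open>T > 0\<close> by (auto simp: h_def min_def)
  then show False using e(2)[of h] before[of k "T - h"] k by force
qed

text \<open>As the closure of the nonvanishing set reaches \<open>\<beta>\<close>, the profile is
  nonzero somewhere beyond \<open>\<gamma>\<close>; monotonicity carries positivity back.\<close>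

lemma influence_profile_pos:
  assumes "influence_profile D \<beta> It" "0 \<le> \<gamma>" "\<gamma> < \<beta>"
  shows "0 < It \<gamma>" "\<beta> \<le> D"
proof -
  have cl: "closure {r\<in>{0..D}. It r \<noteq> 0} = {0..\<beta>}" and nn: "\<And>r. r \<in> {0..D} \<Longrightarrow> 0 \<le> It r"
    and anti: "antimono_on {0..D} It"
    using assms by (auto simp: influence_profile_def)
  have "{0..\<beta>} \<subseteq> {0..D}" unfolding cl[symmetric] by (rule closure_minimal) auto
  with assms show "\<beta> \<le> D" by auto
  have "\<not> {r\<in>{0..D}. It r \<noteq> 0} \<subseteq> {0..\<gamma>}"
  proof
    assume "{r\<in>{0..D}. It r \<noteq> 0} \<subseteq> {0..\<gamma>}"
    then have "{0..\<beta>} \<subseteq> {0..\<gamma>}" unfolding cl[symmetric] by (rule closure_minimal) auto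
    with assms show False by auto
  qed
  then obtain r where r: "r \<in> {0..D}" "It r \<noteq> 0" "\<gamma> < r" by force
  then have "It r \<le> It \<gamma>" using anti assms by (auto simp: monotone_on_def)
  moreover have "0 < It r" using nn[OF r(1)] r(2) by simp
  ultimately show "0 < It \<gamma>" by simp
qed

theorem theorem5p1:
  fixes N :: nat
    and \<Omega> :: "real^'n^'n"
    and \<kappa> \<beta> \<gamma>0 \<gamma> :: real
    and It :: "real \<Rightarrow> real"
    and R0 :: "nat \<Rightarrow> real^'n^'n"
    and R :: "nat \<Rightarrow> real \<Rightarrow> real^'n^'n"
  assumes "\<Omega> \<in> so"
    and "\<kappa> > 0"
    and "0 < \<beta>" and "\<beta> < pi / 2"
    and "influence_profile (real (CARD('n) div 2) * pi) \<beta> It"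
    and "0 < \<gamma>0" and "\<gamma>0 < 2 * sin (\<beta> / 2)"
    and "\<gamma> = 2 * arcsin (\<gamma>0 / 2)" and "\<gamma> < \<beta>"
    and "\<kappa> > mat_norm \<Omega> / (It \<gamma> * sin (2 * sin (\<gamma> / 2)))"
    and "\<forall>i\<in>{1..N}. R0 i \<in> geo_ball \<gamma>0"
    and "winfree_solution N \<Omega> \<kappa> It R0 R"
  shows "\<kappa> * cos \<gamma> * It \<gamma> > 0 \<and>
    (\<forall>t>0. \<forall>i\<in>{1..N}. \<forall>j\<in>{1..N}.
       mat_norm (R i t - R j t) \<le> exp (- (\<kappa> * cos \<gamma> * It \<gamma>) * t) * mat_norm (R0 i - R0 j))"
proof -
  have "\<gamma>0 < 2" using assms(7) sin_le_one[of "\<beta> / 2"] by linarith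
  then have \<gamma>02: "\<gamma>0 / 2 \<in> {0<..<1}" using assms(6) by auto
  then have sin\<gamma>: "2 * sin (\<gamma> / 2) = \<gamma>0" using assms(8) by simp
  have \<gamma>: "0 < \<gamma>" "\<gamma> < pi / 2" using assms(4,8,9) \<gamma>02 arcsin_less_arcsin[of 0 "\<gamma>0 / 2"] by auto
  then have trig: "cos \<gamma> > 0" "sin \<gamma> > 0" using sin_gt_zero[of \<gamma>] by (auto intro: cos_gt_zero)
  \<comment> \<open>Squared radius of the chordal ball to be kept invariant;
    \<open>arccos (1 - D0 / 2)\<close> is \<open>\<gamma>\<close>.\<close>
  define D0 where "D0 = \<gamma>0^2"
  have cos\<gamma>: "cos \<gamma> = 1 - D0 / 2"
    using cos_double_sin[of "\<gamma> / 2"] by (simp add: D0_def power2_eq_square flip: sin\<gamma>)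
  with trig(1) have D02: "D0 < 2" by simp
  have sin2: "D0 * (4 - D0) = 4 * (sin \<gamma>)^2"
    unfolding sin_squared_eq cos\<gamma> by (simp add: power2_eq_square algebra_simps)
  have It\<gamma>: "0 < It \<gamma>" and \<beta>D: "\<beta> \<le> real (CARD('n) div 2) * pi"
    using influence_profile_pos[OF assms(5) _ assms(9)] \<gamma> by auto
  have anti: "antimono_on {0..real (CARD('n) div 2) * pi} It"
    using assms(5) by (simp add: influence_profile_def)
  show ?thesis
  proof (intro conjI allI impI ballI)
    show "\<kappa> * cos \<gamma> * It \<gamma> > 0" using assms(2) trig It\<gamma> by simp
  next
    fix t :: real and i j
    assume t: "t > 0" and ij: "i \<in> {1..N}" "j \<in> {1..N}"
    then have N: "N > 0" by auto
    have SO: "R k s \<in> SO" and cont: "continuous_on {0..} (R k)" and init: "R k 0 = R0 k"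
      if "k \<in> {1..N}" "s \<ge> 0" for k s
      using assms(12) that by (auto simp: winfree_solution_def)
    define \<sigma> where "\<sigma> = (\<lambda>s. \<kappa> * (1 / real N * (\<Sum>j\<in>{1..N}. influence It (R j s))))"
    have ode: "(R k has_vector_derivative \<Omega> ** R k s + (\<sigma> s / 2) *\<^sub>R (mat 1 - R k s ** R k s)) (at s)"
      if "k \<in> {1..N}" "s > 0" for k s
    proof -
      have "\<sigma> s / 2 = \<kappa> / 2 * (1 / real N * (\<Sum>j\<in>{1..N}. influence It (R j s)))" by (simp add: \<sigma>_def)
      then show ?thesis using assms(12) that unfolding winfree_solution_def by metis
    qed
    have orth: "orthogonal_matrix (R k s)" if "k \<in> {1..N}" "s \<ge> 0" for k s
      using SO[OF that] by (simp add: SO_def rotation_matrix_def)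
    define D where "D = (\<lambda>k s. real CARD('n) - trace (R k s))"
    have \<sigma>: "\<kappa> * It \<gamma> \<le> \<sigma> s" if s: "s \<ge> 0" and le: "\<And>k. k \<in> {1..N} \<Longrightarrow> D k s \<le> D0" for s
    proof -
      have "It \<gamma> \<le> influence It (R k s)" if k: "k \<in> {1..N}" for k
      proof -
        have "geo_dist (mat 1) (R k s) \<in> {0..\<gamma>}"
          using geo_dist_mat_1_le[OF SO[OF k s], of D0] le[OF k] D02 \<gamma>
          by (simp add: D_def cos\<gamma>[symmetric] arccos_cos)
        then show ?thesis
          using anti \<gamma> \<beta>D assms(9) by (auto simp: influence_def monotone_on_def)
      qed
      then have "(\<Sum>k\<in>{1..N}. It \<gamma>) \<le> (\<Sum>k\<in>{1..N}. influence It (R k s))" by (rule sum_mono)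
      then have "It \<gamma> \<le> 1 / real N * (\<Sum>k\<in>{1..N}. influence It (R k s))"
        using N by (simp add: field_simps)
      then show ?thesis unfolding \<sigma>_def using assms(2) by (intro mult_left_mono) auto
    qed
    \<comment> \<open>The inner argument \<open>2 * sin (\<gamma> / 2)\<close> is at most
      \<open>\<gamma>\<close>, so the hypothesis on \<open>\<kappa>\<close> implies this bound with
      \<open>sin \<gamma>\<close>.\<close>
    have strong: "mat_norm \<Omega> < \<kappa> * It \<gamma> * sin \<gamma>"
    proof -
      have "2 * sin (\<gamma> / 2) \<le> \<gamma>" using sin_x_le_x[of "\<gamma> / 2"] \<gamma> by simp
      then have "0 < sin (2 * sin (\<gamma> / 2))" "sin (2 * sin (\<gamma> / 2)) \<le> sin \<gamma>"
        using \<gamma> assms(6) sin\<gamma> by (auto intro!: sin_gt_zero sin_monotone_2pi_le)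
      then have "mat_norm \<Omega> < \<kappa> * (It \<gamma> * sin (2 * sin (\<gamma> / 2)))"
        using assms(10) It\<gamma> by (simp add: pos_divide_less_eq)
      also have "\<dots> \<le> \<kappa> * (It \<gamma> * sin \<gamma>)"
        using assms(2) It\<gamma> \<open>sin (2 * sin (\<gamma> / 2)) \<le> sin \<gamma>\<close> by simp
      finally show ?thesis by (simp add: mult.assoc)
    qed
    have dD: "(D k has_real_derivative
        - trace (\<Omega> ** R k s) - \<sigma> s / 2 * (real CARD('n) - trace (R k s ** R k s))) (at s)"
      if "k \<in> {1..N}" "s > 0" for k s
    proof -
      have "((\<lambda>s. mat 1 \<bullet> R k s) has_vector_derivative
          mat 1 \<bullet> (\<Omega> ** R k s + (\<sigma> s / 2) *\<^sub>R (mat 1 - R k s ** R k s))) (at s)"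
        by (rule bounded_linear.has_vector_derivative[OF bounded_linear_inner_right ode[OF that]])
      then show ?thesis unfolding D_def has_real_derivative_iff_has_vector_derivative
        by (auto simp: inner_mat_1 inner_add_right inner_diff_right trace_I intro!: derivative_eq_intros)
    qed
    have small: "D k s < D0" if "k \<in> {1..N}" "s \<ge> 0" for k s
    proof (rule barrier[of "{1..N}" D])
      show "continuous_on {0..} (D k)" if "k \<in> {1..N}" for k
        unfolding D_def inner_mat_1[symmetric] by (intro continuous_intros cont[OF that order_refl])
      show "D k 0 < D0" if "k \<in> {1..N}" for k
        unfolding D_def D0_def init[OF that order_refl] using assms(11) that geo_ball_imp_trace by blast
      fix k s
      assume k: "k \<in> {1..N}" and s: "s > 0" and eq: "D k s = D0" and le: "\<forall>l\<in>{1..N}. D l s \<le> D0"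
      define E where "E = real CARD('n) - trace (R k s ** R k s)"
      \<comment> \<open>The drift is at most \<open>mat_norm \<Omega> * sqrt E\<close> and the
        coupling removes \<open>\<sigma> s / 2 * E\<close>. The coupling wins because
        \<open>sqrt E \<ge> 2 * sin \<gamma>\<close>.\<close>
      have "4 * (sin \<gamma>)^2 \<le> E"
        using orthogonal_trace_square_le[OF orth[OF k], of s] s eq D02 unfolding sin2[symmetric] by (simp add: D_def E_def)
      then have sE: "2 * sin \<gamma> \<le> sqrt E" using real_le_rsqrt[of "2 * sin \<gamma>" E] by (simp add: power_mult_distrib)
      have E: "E = sqrt E * sqrt E" using order_trans[OF _ \<open>4 * (sin \<gamma>)^2 \<le> E\<close>, of 0] by simp
      have "\<kappa> * It \<gamma> \<le> \<sigma> s" using \<sigma>[of s] le s by auto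
      moreover have "0 \<le> \<kappa> * It \<gamma>" using assms(2) It\<gamma> by simp
      ultimately have "\<kappa> * It \<gamma> * sin \<gamma> \<le> \<sigma> s / 2 * sqrt E"
        using mult_mono[OF _ sE, of "\<kappa> * It \<gamma>" "\<sigma> s"] trig(2) by simp
      then have "mat_norm \<Omega> * sqrt E < \<sigma> s / 2 * sqrt E * sqrt E"
        using strong sE trig(2) by (intro mult_strict_right_mono) linarith+
      moreover have "- trace (\<Omega> ** R k s) \<le> mat_norm \<Omega> * sqrt E"
        using trace_skew_mult_le[OF assms(1) orth[OF k], of s] s by (simp add: E_def)
      ultimately have "- trace (\<Omega> ** R k s) - \<sigma> s / 2 * E < 0"
        using E by (simp add: mult.assoc)
      then show "\<exists>d<0. (D k has_real_derivative d) (at s)" using dD[OF k s] unfolding E_def by blast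
    qed (use that in auto)
    define \<rho> where "\<rho> = \<kappa> * cos \<gamma> * It \<gamma>"
    define X where "X = (\<lambda>s. R i s - R j s)"
    \<comment> \<open>The exponential weight turns the decay estimate into monotonicity of
      \<open>g\<close>; the factor 2 accounts for the squared norm.\<close>
    define g where "g = (\<lambda>s. exp (2 * \<rho> * s) * (X s \<bullet> X s))"
    have "g t \<le> g 0"
    proof (rule DERIV_nonpos_imp_decreasing_open[of 0 t g])
      show "continuous_on {0..t} g"
        unfolding g_def X_def
        by (intro continuous_intros continuous_on_subset[OF cont[OF ij(1) order_refl]]
            continuous_on_subset[OF cont[OF ij(2) order_refl]]) auto
      fix s assume s: "0 < s" "s < t"
      let ?P = "R i s" and ?Q = "R j s"
      \<comment> \<open>All oscillators share \<open>\<sigma>\<close>, so in the difference the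
        identity terms cancel and only the squares remain; the \<open>\<Omega>\<close> term is
        orthogonal to \<open>X s\<close>.\<close>
      define X' where "X' = \<Omega> ** X s - (\<sigma> s / 2) *\<^sub>R (?P ** ?P - ?Q ** ?Q)"
      have "(X has_vector_derivative X') (at s)"
        unfolding X_def X'_def
        by (auto intro!: derivative_eq_intros ode ij s simp: matmul.diff_right algebra_simps)
      then have "((\<lambda>s. X s \<bullet> X s) has_vector_derivative (X s \<bullet> X' + X' \<bullet> X s)) (at s)"
        by (intro bounded_bilinear.has_vector_derivative[OF bounded_bilinear_inner])
      then have "((\<lambda>s. X s \<bullet> X s) has_real_derivative 2 * (X s \<bullet> X')) (at s)"
        by (simp add: has_real_derivative_iff_has_vector_derivative inner_commute)
      then have "(g has_real_derivative exp (2 * \<rho> * s) * (2 * \<rho> * (X s \<bullet> X s) + 2 * (X s \<bullet> X'))) (at s)"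
        unfolding g_def by (auto intro!: derivative_eq_intros simp: algebra_simps)
      moreover have "\<rho> * (X s \<bullet> X s) + X s \<bullet> X' \<le> 0"
      proof -
        have 1: "2 * cos \<gamma> * (X s \<bullet> X s) \<le> X s \<bullet> (?P ** ?P - ?Q ** ?Q)"
          using orthogonal_square_inner_ge[of ?P D0 ?Q] orth ij s small[of _ s] D02
          by (auto simp: X_def cos\<gamma> D_def less_imp_le)
        have "\<kappa> * It \<gamma> \<le> \<sigma> s" using \<sigma>[of s] small[of _ s] s by (auto simp: less_imp_le)
        then have "\<kappa> * It \<gamma> * (cos \<gamma> * (X s \<bullet> X s)) \<le> \<sigma> s * (cos \<gamma> * (X s \<bullet> X s))"
          using trig by (intro mult_right_mono) auto
        then have "\<rho> * (X s \<bullet> X s) \<le> \<sigma> s / 2 * (2 * cos \<gamma> * (X s \<bullet> X s))"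
          by (simp add: \<rho>_def mult_ac)
        also have "\<dots> \<le> \<sigma> s / 2 * (X s \<bullet> (?P ** ?P - ?Q ** ?Q))"
        proof (rule mult_left_mono[OF 1])
          have "0 \<le> \<kappa> * It \<gamma>" using assms(2) It\<gamma> by simp
          with \<open>\<kappa> * It \<gamma> \<le> \<sigma> s\<close> show "0 \<le> \<sigma> s / 2" by simp
        qed
        finally show ?thesis
          by (simp add: X'_def inner_diff_right skew_matrix_inner_eq_0[OF assms(1)])
      qed
      then have "exp (2 * \<rho> * s) * (2 * \<rho> * (X s \<bullet> X s) + 2 * (X s \<bullet> X')) \<le> 0"
        by (simp add: mult_le_0_iff)
      ultimately show "\<exists>y. (g has_real_derivative y) (at s) \<and> y \<le> 0" by blast
    qed (use t in auto)
    then have "(exp (\<rho> * t) * norm (X t))^2 \<le> (norm (X 0))^2"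
      by (simp add: g_def power_mult_distrib power2_norm_eq_inner exp_double[symmetric] mult.assoc)
    then have "exp (\<rho> * t) * norm (X t) \<le> norm (X 0)" by (rule power2_le_imp_le) simp
    then have "norm (X t) \<le> exp (- \<rho> * t) * norm (X 0)"
      by (simp add: exp_minus field_simps)
    then show "mat_norm (R i t - R j t) \<le> exp (- (\<kappa> * cos \<gamma> * It \<gamma>) * t) * mat_norm (R0 i - R0 j)"
      using init[OF ij(1) order_refl] init[OF ij(2) order_refl] unfolding mat_norm_eq \<rho>_def X_def
      by (simp add: divide_right_mono)
  qed
qed

end
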